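(* Let $K$ be an $o$-symmetric convex body in the plane $\mathbb{R}^2$ that is not a quasi hexagon. Then for every positive integer $n$, $$c_{\mathrm{sep}}(K,n)\leq\left\lfloor 2n-2\sqrt{n}\right\rfloor.$$
   Context: A convex body is a compact convex set with nonempty interior; it is $o$-symmetric if $K=-K$. For an $o$-symmetric convex body $K$, $\|\cdot\|_K$ denotes the norm with unit ball $K$. An $o$-symmetric planar convex body $K$ is called a quasi hexagon if its boundary contains two non-collinear line segments with a common endpoint, each of length at least $1$ in the norm $\|\cdot\|_K$. A translative packing of $K$ is a finite collection $\{x_1+K,\dots,x_n+K\}$ of (distinct) translates of $K$ such that no two of them have interior points in common. Two translates in the packing touch if they have a common boundary point. The packing is totally separable if any two touching translates in it have a separating line that does not intersect the interior of any translate in the packing. The contact number of a packing is the number of (unordered) touching pairs of translates in it. $c_{\mathrm{sep}}(K,n)$ denotes the largest contact number of a totally separable packing of $n$ translates of $K$. *)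

theory Defs
  imports "HOL-Analysis.Analysis"
begin

type_synonym plane = "real ^ 2"

definition convex_body :: "plane set \<Rightarrow> bool" where
  "convex_body K \<longleftrightarrow> compact K \<and> convex K \<and> interior K \<noteq> {}"

definition o_symmetric :: "plane set \<Rightarrow> bool" where
  "o_symmetric K \<longleftrightarrow> K = uminus ` K"

(* The norm with unit ball K, as the Minkowski functional of K. *)
definition body_norm :: "plane set \<Rightarrow> plane \<Rightarrow> real" where
  "body_norm K x = Inf {t. 0 < t \<and> x \<in> (\<lambda>y. t *\<^sub>R y) ` K}"

(* Two segments with the common endpoint p are non-collinear iff their three endpoints are. *)
definition quasi_hexagon :: "plane set \<Rightarrow> bool" where
  "quasi_hexagon K \<longleftrightarrow>
     (\<exists>p q r. closed_segment p q \<subseteq> frontier K \<and> closed_segment p r \<subseteq> frontier K \<and>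
        \<not> collinear {p, q, r} \<and>
        1 \<le> body_norm K (q - p) \<and> 1 \<le> body_norm K (r - p))"

definition translative_packing :: "plane set \<Rightarrow> plane set set \<Rightarrow> bool" where
  "translative_packing K P \<longleftrightarrow>
     finite P \<and> (\<forall>A\<in>P. \<exists>x. A = (\<lambda>y. x + y) ` K) \<and>
     pairwise (\<lambda>A B. interior A \<inter> interior B = {}) P"

definition touching :: "plane set \<Rightarrow> plane set \<Rightarrow> bool" where
  "touching A B \<longleftrightarrow> A \<noteq> B \<and> frontier A \<inter> frontier B \<noteq> {}"

(* The line {x. a \<bullet> x = b} separates A from B; replacing (a, b) by (-a, -b) exchanges
   the roles of the two closed half-planes. *)
definition separating_line :: "plane \<Rightarrow> real \<Rightarrow> plane set \<Rightarrow> plane set \<Rightarrow> bool" where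
  "separating_line a b A B \<longleftrightarrow>
     a \<noteq> 0 \<and> A \<subseteq> {x. a \<bullet> x \<le> b} \<and> B \<subseteq> {x. a \<bullet> x \<ge> b}"

definition totally_separable :: "plane set set \<Rightarrow> bool" where
  "totally_separable P \<longleftrightarrow>
     (\<forall>A\<in>P. \<forall>B\<in>P. touching A B \<longrightarrow>
        (\<exists>a b. separating_line a b A B \<and> (\<forall>C\<in>P. {x. a \<bullet> x = b} \<inter> interior C = {})))"

definition contact_number :: "plane set set \<Rightarrow> nat" where
  "contact_number P = card {{A, B} | A B. A \<in> P \<and> B \<in> P \<and> touching A B}"

(* For a convex body K the maximum is over a finite nonempty set: contact numbers of packings
   of n translates are at most n choose 2, and n pairwise disjoint translates placed along a
   line form a totally separable packing without contacts. *)
definition c_sep :: "plane set \<Rightarrow> nat \<Rightarrow> nat" where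
  "c_sep K n =
     Max {contact_number P | P. translative_packing K P \<and> totally_separable P \<and> card P = n}"

end

theory Submission
  imports Defs
begin

text \<open>
  The contacts of a packing are coloured by direction. Fix two axes \<open>e\<close> and \<open>f\<close> in \<open>K\<close> that are conjugate,
  which means that \<open>K\<close> lies in the parallelogram with the centres of its sides at \<open>e\<close>, \<open>f\<close>, \<open>- e\<close>, \<open>- f\<close>
  (\<open>conjugate_frame\<close>). A contact between the translates with centres \<open>x\<close> and \<open>y\<close> is horizontal if \<open>y - x\<close>
  is in the first or third quadrant with respect to these axes, and vertical otherwise.

  The line that separates touching translates supports \<open>K\<close> at half of the difference of their centres,
  and it does not cut any other neighbour. In this sense the angle between two contacts of one translate is
  at least right, and a quadrant contains at most one of them (\<open>one_contact_per_quadrant\<close>). So the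
  horizontal contacts form disjoint paths, and so do the vertical ones. A horizontal and a vertical path
  share at most one translate, because the difference of two centres would lie in quadrants of both kinds
  (\<open>paths_meet_once\<close>). With $r$ horizontal and $s$ vertical paths there are $(n - r) + (n - s)$
  contacts, and $n \leq r s$, which gives the bound (\<open>two_path_families_bound\<close>).

  Two points need care. A contact along an axis belongs to two quadrants. It is put into the one
  towards which the normal of its separating line tilts. And two neighbours of a translate can lie beyond the same edge of \<open>K\<close>,
  so that one line separates both. If \<open>K\<close> has an edge longer than one, then \<open>e\<close> is chosen parallel to it
  and \<open>f\<close> on it; the parts of all edges within one quadrant then have length at most one
  (\<open>short_faces_frame_exists\<close>). Two neighbours beyond the same edge in one quadrant therefore touch each
  other, and the line between them produces another edge of length at least one with a common endpoint,
  which is possible for quasi hexagons only (\<open>contacts_no_common_face\<close>).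
\<close>

section \<open>Graphs that split into two families of paths\<close>

lemma path_sink:
  assumes "finite R" "R \<subseteq> X \<times> X" "acyclic R" "x \<in> X"
  shows "\<exists>s. s \<in> X - Domain R \<and> (x, s) \<in> R\<^sup>*"
proof -
  have "wf (R\<inverse>)"
    using assms by (simp add: finite_acyclic_wf_converse)
  then have "x \<in> X \<longrightarrow> (\<exists>s. s \<in> X - Domain R \<and> (x, s) \<in> R\<^sup>*)"
  proof (induction x rule: wf_induct_rule)
    case (less x)
    show ?case
    proof (cases "x \<in> Domain R")
      case True
      then obtain y where y: "(x, y) \<in> R" by blast
      then have "y \<in> X" using assms by blast
      then show ?thesis
        using less.IH[of y] y by (meson converse_iff converse_rtrancl_into_rtrancl)
    qed auto
  qed
  then show ?thesis using assms by blast
qed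

text \<open>With $r$ paths in one family and $s$ in the other, the graph has $(n - r) + (n - s)$ edges. A vertex is
  determined by the two paths through it, named here by their last vertices, so $n \leq r s$, and
  $r + s \geq 2 \sqrt{n}$ by the inequality of the means. Isolated vertices count as paths.\<close>

lemma two_path_families_bound:
  assumes "finite X"
    and H: "H \<subseteq> X \<times> X" "single_valued H" "single_valued (H\<inverse>)" "acyclic H"
    and V: "V \<subseteq> X \<times> X" "single_valued V" "single_valued (V\<inverse>)" "acyclic V"
    and HV: "H\<^sup>+ \<inter> V\<^sup>+ = {}" "H\<^sup>+ \<inter> (V\<^sup>+)\<inverse> = {}"
  shows "real (card H + card V) \<le> 2 * real (card X) - 2 * sqrt (real (card X))"
proof -
  have fin: "finite H" "finite V"
    using assms by (meson finite_SigmaI finite_subset)+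
  have card_Domain: "card R + card (X - Domain R) = card X"
    if "R \<subseteq> X \<times> X" "single_valued R" for R :: "('a \<times> 'a) set"
  proof -
    have "bij_betw fst R (Domain R)"
      using that by (auto simp: bij_betw_def inj_on_def single_valued_def Domain_fst)
    then have "card R = card (Domain R)" by (rule bij_betw_same_card)
    moreover have "Domain R \<subseteq> X" using that by blast
    ultimately show ?thesis
      using \<open>finite X\<close> by (metis add_diff_inverse_nat card_Diff_subset card_mono finite_subset not_le)
  qed
  obtain h where h: "\<And>x. x \<in> X \<Longrightarrow> h x \<in> X - Domain H \<and> (x, h x) \<in> H\<^sup>*"
    using path_sink[OF fin(1) H(1,4)] by metis
  obtain v where v: "\<And>x. x \<in> X \<Longrightarrow> v x \<in> X - Domain V \<and> (x, v x) \<in> V\<^sup>*"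
    using path_sink[OF fin(2) V(1,4)] by metis
  have same_path: "(x, y) \<in> R\<^sup>* \<or> (y, x) \<in> R\<^sup>*"
    if "single_valued (R\<inverse>)" "(x, s) \<in> R\<^sup>*" "(y, s) \<in> R\<^sup>*" for R :: "('a \<times> 'a) set" and x y s
    using single_valued_confluent[OF that(1), of s x y] that(2,3) by (auto simp: rtrancl_converse)
  have "inj_on (\<lambda>x. (h x, v x)) X"
  proof (rule inj_onI, rule ccontr)
    fix x y assume xy: "x \<in> X" "y \<in> X" "(h x, v x) = (h y, v y)" "x \<noteq> y"
    have "(x, y) \<in> H\<^sup>+ \<or> (y, x) \<in> H\<^sup>+"
      using same_path[OF H(3), of x "h x" y] h xy by (metis prod.inject rtranclD)
    moreover have "(x, y) \<in> V\<^sup>+ \<or> (y, x) \<in> V\<^sup>+"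
      using same_path[OF V(3), of x "v x" y] v xy by (metis prod.inject rtranclD)
    ultimately show False using HV by blast
  qed
  moreover have "(\<lambda>x. (h x, v x)) ` X \<subseteq> (X - Domain H) \<times> (X - Domain V)"
    using h v by blast
  ultimately have "card X \<le> card (X - Domain H) * card (X - Domain V)"
    using card_inj_on_le[of "\<lambda>x. (h x, v x)" X "(X - Domain H) \<times> (X - Domain V)"] \<open>finite X\<close>
    by (simp add: card_cartesian_product)
  then have "sqrt (real (card X)) \<le> sqrt (real (card (X - Domain H)) * real (card (X - Domain V)))"
    by (metis of_nat_le_iff of_nat_mult real_sqrt_le_iff)
  also have "\<dots> \<le> (real (card (X - Domain H)) + real (card (X - Domain V))) / 2"
    by (rule arith_geo_mean_sqrt) auto
  finally show ?thesis
    using card_Domain[OF H(1,2), THEN arg_cong[of _ _ real]]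
      card_Domain[OF V(1,2), THEN arg_cong[of _ _ real]] by simp
qed

section \<open>Symmetric bodies\<close>

locale symmetric_body =
  fixes K :: "plane set"
  assumes body: "convex_body K" and symmetric: "o_symmetric K"
begin

lemma uminus_in [simp]: "- k \<in> K \<longleftrightarrow> k \<in> K"
  using symmetric unfolding o_symmetric_def by (metis image_eqI minus_minus imageE)

lemma convex_K: "convex K" and compact_K: "compact K" and closed_K: "closed K"
  using body by (auto simp: convex_body_def compact_imp_closed)

lemma zero_interior: "0 \<in> interior K"
proof -
  obtain c where c: "c \<in> interior K" using body by (auto simp: convex_body_def)
  have "- c \<in> K" using c interior_subset by fastforce
  then have "- c - (1/2) *\<^sub>R (- c - c) \<in> interior K"
    by (intro mem_interior_convex_shrink convex_K c) auto
  moreover have "- c - (1/2) *\<^sub>R (- c - c) = 0"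
    by (simp add: vec_eq_iff)
  ultimately show ?thesis by simp
qed

lemma zero_in: "0 \<in> K"
  using zero_interior interior_subset by blast

lemma shrink_interior:
  assumes "k \<in> K" "\<bar>s\<bar> < 1"
  shows "s *\<^sub>R k \<in> interior K"
proof -
  have pos: "s *\<^sub>R k \<in> interior K" if "k \<in> K" "0 \<le> s" "s < 1" for s k
    using mem_interior_convex_shrink[OF convex_K zero_interior that(1), of "1 - s"] that
    by (simp add: algebra_simps)
  show ?thesis
    using pos[of k s] pos[of "- k" "- s"] assms by (cases "0 \<le> s") auto
qed

lemma shrink_in:
  assumes "k \<in> K" "\<bar>s\<bar> \<le> 1"
  shows "s *\<^sub>R k \<in> K"
proof (cases "\<bar>s\<bar> = 1")
  case True
  then have "s = 1 \<or> s = -1" by linarith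
  then show ?thesis using assms by auto
next
  case False
  then show ?thesis using shrink_interior[OF assms(1), of s] assms(2) interior_subset by fastforce
qed

lemma frontier_iff: "u \<in> frontier K \<longleftrightarrow> u \<in> K \<and> u \<notin> interior K"
  using closed_K by (simp add: frontier_def)

lemma interior_uminus [simp]: "- u \<in> interior K \<longleftrightarrow> u \<in> interior K"
proof -
  have "interior K = uminus ` interior K"
    using symmetric interior_negations[of K] by (simp add: o_symmetric_def)
  then show ?thesis by (metis image_eqI minus_minus imageE)
qed

lemma one_le_body_norm:
  assumes "u \<notin> interior K"
  shows "1 \<le> body_norm K u"
  unfolding body_norm_def
proof (rule cInf_greatest)
  obtain r where r: "r > 0" "ball 0 r \<subseteq> K"
    using zero_interior mem_interior by blast
  define t where "t = 2 * (norm u + 1) / r"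
  have t: "0 < t" using r by (simp add: t_def add_nonneg_pos)
  have "norm u * r < 2 * (norm u + 1) * r" 
    using r by (intro mult_strict_right_mono)
      (auto simp: add_nonneg_pos intro: le_less_trans[of _ "norm u + 1"])
  then have "(1 / t) *\<^sub>R u \<in> ball 0 r"
    using r t by (simp add: t_def field_simps add_pos_nonneg)
  then have "(1 / t) *\<^sub>R u \<in> K" using r by blast
  then have "t \<in> {t. 0 < t \<and> u \<in> (\<lambda>y. t *\<^sub>R y) ` K}"
    using t by (auto intro!: image_eqI[of _ _ "(1 / t) *\<^sub>R u"])
  then show "{t. 0 < t \<and> u \<in> (\<lambda>y. t *\<^sub>R y) ` K} \<noteq> {}" by blast
next
  fix t assume "t \<in> {t. 0 < t \<and> u \<in> (\<lambda>y. t *\<^sub>R y) ` K}"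
  then show "1 \<le> t"
    using assms shrink_interior[of _ t] by (force simp: not_le[symmetric])
qed

text \<open>A separating line enters the argument only through its normal, as a functional attaining its
  maximum over \<open>K\<close> at a given point.\<close>

definition supports :: "plane \<Rightarrow> plane \<Rightarrow> bool" where
  "supports a u \<longleftrightarrow> a \<noteq> 0 \<and> u \<in> K \<and> (\<forall>k\<in>K. a \<bullet> k \<le> a \<bullet> u)"

lemma supportsD:
  assumes "supports a u"
  shows "a \<noteq> 0" "u \<in> K" "k \<in> K \<Longrightarrow> a \<bullet> k \<le> a \<bullet> u" "k \<in> K \<Longrightarrow> - (a \<bullet> u) \<le> a \<bullet> k"
  using assms by (auto simp: supports_def) (metis inner_minus_right minus_le_iff uminus_in)

lemma supports_uminus:
  assumes "supports a u"
  shows "supports (- a) (- u)"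
  using supportsD(1,2)[OF assms] supportsD(4)[OF assms] by (auto simp: supports_def minus_le_iff)

lemma supports_not_interior:
  assumes "supports a u"
  shows "u \<notin> interior K"
proof
  assume "u \<in> interior K"
  then obtain r where r: "r > 0" "ball u r \<subseteq> K" using mem_interior by blast
  have a: "a \<noteq> 0" using supportsD[OF assms] by blast
  have "u + (r / (2 * norm a)) *\<^sub>R a \<in> K"
    using r a by (intro subsetD[OF r(2)]) (simp add: dist_norm)
  then have "a \<bullet> (u + (r / (2 * norm a)) *\<^sub>R a) \<le> a \<bullet> u" by (rule supportsD[OF assms])
  moreover have "0 < (r / (2 * norm a)) * (a \<bullet> a)" using r a by simp
  ultimately show False by (simp add: inner_add_right)
qed

lemma supports_pos:
  assumes "supports a u"
  shows "0 < a \<bullet> u"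
proof -
  have "0 \<le> a \<bullet> u" using supportsD(3)[OF assms zero_in] by simp
  moreover have "a \<bullet> u \<noteq> 0"
  proof
    assume "a \<bullet> u = 0"
    then have "supports a 0" using assms zero_in by (simp add: supports_def)
    then show False using supports_not_interior zero_interior by blast
  qed
  ultimately show ?thesis by simp
qed

lemma supports_exists:
  assumes "u \<in> frontier K"
  obtains a where "supports a u"
proof -
  have u: "u \<in> K" "u \<notin> rel_interior K"
    using assms zero_interior rel_interior_nonempty_interior[of K] by (auto simp: frontier_iff)
  obtain a where "a \<noteq> 0" "\<And>y. y \<in> K \<Longrightarrow> a \<bullet> u \<le> a \<bullet> y"
    using supporting_hyperplane_rel_boundary[OF convex_K u] by metis
  then have "supports (- a) u" using u by (simp add: supports_def)
  then show thesis by (rule that)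
qed

lemma common_face_segment:
  assumes "supports a u" "supports a w"
  shows "closed_segment u w \<subseteq> frontier K"
proof
  fix z assume z: "z \<in> closed_segment u w"
  then have "z \<in> K" using assms convex_K closed_segment_subset supportsD(2) by blast
  moreover have "a \<bullet> u = a \<bullet> w" using assms by (meson antisym supportsD(2,3))
  then have "a \<bullet> z = a \<bullet> u"
    using z by (auto simp: in_segment inner_add_right simp flip: distrib_right)
  ultimately have "supports a z" using assms by (simp add: supports_def)
  then show "z \<in> frontier K" using supports_not_interior \<open>z \<in> K\<close> frontier_iff by blast
qed

text \<open>The faces cut out by \<open>a\<close> and \<open>b\<close> share the endpoint \<open>u\<close>. The one contains the segment from \<open>u\<close> to
  \<open>w\<close>, whose direction is outside the interior of \<open>K\<close>, the other the segment from \<open>u\<close> to \<open>u - w\<close>, whose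
  direction \<open>- w\<close> is in the frontier. They are not collinear because \<open>b\<close> vanishes on \<open>w\<close> but not on \<open>u\<close>.\<close>

lemma quasi_hexagonI:
  assumes "supports a u" "supports a w" "u - w \<notin> interior K"
    and "supports b u" "supports b (u - w)"
  shows "quasi_hexagon K"
proof -
  have bw: "b \<bullet> w = 0"
  proof -
    have "b \<bullet> u = b \<bullet> (u - w)" using assms by (meson antisym supportsD(2,3))
    then show ?thesis by (simp add: inner_diff_right)
  qed
  have w: "w \<notin> interior K" by (rule supports_not_interior[OF assms(2)])
  have "\<not> collinear {u, w, u - w}"
  proof
    assume "collinear {u, w, u - w}"
    then have "collinear {0, w - u, - w}"
      using collinear_3[of w u "u - w"] by (simp add: NO_MATCH_def insert_commute)
    then consider "w - u = 0" | "w = 0" | c where "- w = c *\<^sub>R (w - u)"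
      unfolding collinear_lemma by auto
    then show False
    proof cases
      case 1
      then show ?thesis using assms(3) zero_interior by simp
    next
      case 2
      then show ?thesis using w zero_interior by simp
    next
      case 3
      then have "b \<bullet> (- w) = c * (b \<bullet> w - b \<bullet> u)" by (simp add: inner_diff_right)
      then have "c = 0" using bw supports_pos[OF assms(4)] by simp
      then show ?thesis using 3 w zero_interior by simp
    qed
  qed
  moreover have "1 \<le> body_norm K (w - u)" "1 \<le> body_norm K (u - w - u)"
    using assms(3) w interior_uminus[of "u - w"] by (auto intro!: one_le_body_norm)
  ultimately show ?thesis
    unfolding quasi_hexagon_def
    using common_face_segment[OF assms(1,2)] common_face_segment[OF assms(4,5)] by blast
qed

end

section \<open>Conjugate frames\<close>

lemma inner_plane: "(a :: plane) \<bullet> b = a $ 1 * b $ 1 + a $ 2 * b $ 2"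
  by (simp add: inner_vec_def sum_2)

text \<open>The axes \<open>e\<close> and \<open>f\<close> generalise a pair of conjugate diameters of an ellipse: the supporting line at
  each of \<open>e\<close>, \<open>f\<close> is parallel to the other. The dual vectors \<open>p\<close> and \<open>q\<close> read off the coordinates.\<close>

locale conjugate_frame = symmetric_body +
  fixes e f p q :: plane
  assumes frame_in: "e \<in> K" "f \<in> K"
    and dual: "p \<bullet> e = 1" "p \<bullet> f = 0" "q \<bullet> e = 0" "q \<bullet> f = 1"
    and p_bound: "\<And>k. k \<in> K \<Longrightarrow> \<bar>p \<bullet> k\<bar> \<le> 1" and q_bound: "\<And>k. k \<in> K \<Longrightarrow> \<bar>q \<bullet> k\<bar> \<le> 1"
begin

lemma coordinates: "u = (p \<bullet> u) *\<^sub>R e + (q \<bullet> u) *\<^sub>R f"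
proof -
  define w where "w = u - ((p \<bullet> u) *\<^sub>R e + (q \<bullet> u) *\<^sub>R f)"
  have w: "p $ 1 * w $ 1 + p $ 2 * w $ 2 = 0" "q $ 1 * w $ 1 + q $ 2 * w $ 2 = 0"
    using dual by (simp_all flip: inner_plane) (simp_all add: w_def inner_add_right inner_diff_right)
  have "(p $ 1 * q $ 2 - p $ 2 * q $ 1) * (e $ 1 * f $ 2 - e $ 2 * f $ 1)
      = (p \<bullet> e) * (q \<bullet> f) - (p \<bullet> f) * (q \<bullet> e)"
    by (simp add: inner_plane algebra_simps)
  then have det: "p $ 1 * q $ 2 - p $ 2 * q $ 1 \<noteq> 0" using dual by auto
  have "(p $ 1 * q $ 2 - p $ 2 * q $ 1) * w $ 1
      = q $ 2 * (p $ 1 * w $ 1 + p $ 2 * w $ 2) - p $ 2 * (q $ 1 * w $ 1 + q $ 2 * w $ 2)"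
    "(p $ 1 * q $ 2 - p $ 2 * q $ 1) * w $ 2
      = p $ 1 * (q $ 1 * w $ 1 + q $ 2 * w $ 2) - q $ 1 * (p $ 1 * w $ 1 + p $ 2 * w $ 2)"
    by (simp_all add: algebra_simps)
  then have "w $ 1 = 0" "w $ 2 = 0" unfolding w using det by auto
  then have "w = 0" by (simp add: vec_eq_iff forall_2)
  then show ?thesis by (simp add: w_def)
qed

lemma inner_coordinates: "a \<bullet> u = (p \<bullet> u) * (a \<bullet> e) + (q \<bullet> u) * (a \<bullet> f)"
  by (subst coordinates[of u]) (simp add: inner_add_right)

lemma eqI_coordinates: "p \<bullet> u = p \<bullet> w \<Longrightarrow> q \<bullet> u = q \<bullet> w \<Longrightarrow> u = w"
  by (metis coordinates)

text \<open>Suppose that the face through \<open>f\<close>, which is parallel to \<open>e\<close>, has length at least one. The farther it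
  extends to the right of \<open>f\<close>, the less room is left in the first quadrant for another face; and the
  farther it extends to the left, the larger is the rectangle below the first axis that \<open>K\<close> contains by
  symmetry. The two effects balance, so that the difference of two points of a face within one quadrant
  stays in \<open>K\<close>.\<close>

lemma common_face_diff_in_quadrant:
  assumes top: "x0 \<le> 0" "0 \<le> x1" "1 \<le> x1 - x0" "x0 *\<^sub>R e + f \<in> K" "x1 *\<^sub>R e + f \<in> K"
    and face: "supports a u" "supports a w"
    and quadrant: "0 \<le> p \<bullet> u" "0 \<le> q \<bullet> u" "0 \<le> p \<bullet> w" "0 \<le> q \<bullet> w"
    and order: "p \<bullet> w \<le> p \<bullet> u"
  shows "u - w \<in> K"
proof -
  define a1 a2 \<alpha> \<beta> \<alpha>' \<beta>'
    where "a1 = a \<bullet> e" "a2 = a \<bullet> f" "\<alpha> = p \<bullet> u" "\<beta> = q \<bullet> u" "\<alpha>' = p \<bullet> w" "\<beta>' = q \<bullet> w"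
  note c = this
  define h where "h = a \<bullet> u"
  have au: "h = \<alpha> * a1 + \<beta> * a2" using inner_coordinates[of a u] by (simp add: c h_def)
  have aw: "h = \<alpha>' * a1 + \<beta>' * a2"
    using inner_coordinates[of a w] face by (metis c(1-6) h_def antisym supportsD(2,3))
  have a1: "\<bar>a1\<bar> \<le> h" and a2: "\<bar>a2\<bar> \<le> h"
    using supportsD(3,4)[OF face(1) frame_in(1)] supportsD(3,4)[OF face(1) frame_in(2)]
    by (auto simp: c h_def)
  have h: "0 < h" using supports_pos[OF face(1)] by (simp add: h_def)
  have le1: "\<alpha> \<le> 1" "\<beta> \<le> 1" "\<alpha>' \<le> 1" "\<beta>' \<le> 1"
    using p_bound[of u] p_bound[of w] q_bound[of u] q_bound[of w] supportsD(2) face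
    by (auto simp: c abs_le_iff)
  have ge0: "0 \<le> \<alpha>" "0 \<le> \<beta>" "0 \<le> \<alpha>'" "0 \<le> \<beta>'" using quadrant by (auto simp: c)
  have diff: "u - w = (\<alpha> - \<alpha>') *\<^sub>R e + (\<beta> - \<beta>') *\<^sub>R f"
    using coordinates[of "u - w"] by (simp add: c inner_diff_right)
  have top_le: "x1 * a1 + a2 \<le> h"
    using supportsD(3)[OF face(1) top(5)] by (simp add: c h_def inner_add_right)
  show ?thesis
  proof (cases "\<beta> > \<beta>'")
    case True
    \<comment> \<open>A face of positive slope in this quadrant would cut off \<open>e\<close> or \<open>f\<close>.\<close>
    have "\<alpha> = \<alpha>'"
    proof (rule ccontr)
      assume "\<alpha> \<noteq> \<alpha>'"
      then have lt: "\<alpha>' < \<alpha>" using order by (simp add: c)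
      have eq: "(\<alpha> - \<alpha>') * a1 = - ((\<beta> - \<beta>') * a2)" using au aw by (simp add: algebra_simps)
      consider "a2 < 0" | "a2 > 0" | "a2 = 0" by linarith
      then show False
      proof cases
        case 1
        then have "(\<alpha> - \<alpha>') * a1 > 0" using eq True by (simp add: mult_less_0_iff)
        then have "a1 > 0" using lt by (simp add: zero_less_mult_iff)
        moreover have "\<beta> * a2 < 0" using 1 True ge0 by (simp add: mult_less_0_iff)
        ultimately show False using au a1 le1 mult_right_mono[of \<alpha> 1 a1] by linarith
      next
        case 2
        then have "(\<alpha> - \<alpha>') * a1 < 0" using eq True by simp
        then have "a1 < 0" using lt by (simp add: mult_less_0_iff)
        then have "\<alpha> * a1 < 0" using lt ge0 by (simp add: mult_less_0_iff)
        then show False using au a2 le1 2 mult_right_mono[of \<beta> 1 a2] by linarith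
      next
        case 3
        then have "a1 = 0" using eq lt by simp
        then show False using 3 au h by simp
      qed
    qed
    then show ?thesis using diff shrink_in[OF frame_in(2), of "\<beta> - \<beta>'"] le1 ge0 by simp
  next
    case False
    show ?thesis
    proof (cases "\<alpha>' < x1")
      case True
      have "(x1 - \<alpha>') * a1 \<le> (\<beta>' - 1) * a2" using top_le aw by (simp add: algebra_simps)
      \<comment> \<open>A face left of the end of the top face is the top face.\<close>
      have "a1 = 0 \<or> \<beta> = \<beta>'"
      proof (rule ccontr)
        assume n: "\<not> (a1 = 0 \<or> \<beta> = \<beta>')"
        have eq: "(\<alpha> - \<alpha>') * a1 = (\<beta>' - \<beta>) * a2" using au aw by (simp add: algebra_simps)
        have lt: "\<beta> < \<beta>'" using n False by simp
        show False
        proof (cases "a2 > 0")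
          case t: True
          then have "(\<alpha> - \<alpha>') * a1 > 0" using eq lt by simp
          then have "a1 > 0" using order by (simp add: c zero_less_mult_iff)
          moreover have "(\<beta>' - 1) * a2 \<le> 0" using t le1 by (simp add: mult_le_0_iff)
          ultimately show False
            using \<open>(x1 - \<alpha>') * a1 \<le> (\<beta>' - 1) * a2\<close> True mult_pos_pos[of "x1 - \<alpha>'" a1] by linarith
        next
          case t: False
          then have b: "\<beta>' * a2 \<le> \<beta> * a2" "\<beta>' * a2 \<le> 0"
            using ge0 lt by (auto simp: mult_right_mono_neg mult_le_0_iff)
          have "a1 > 0"
            using aw h b ge0 by (smt (verit) mult_nonneg_nonpos)
          have "\<alpha>' * a1 \<le> a1" using \<open>a1 > 0\<close> le1 mult_right_mono[of \<alpha>' 1 a1] by simp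
          then have "\<beta>' * a2 = 0" "\<alpha>' * a1 = a1" using aw a1 b \<open>a1 > 0\<close> by linarith+
          then have "a2 = 0" "\<alpha>' = 1" using lt ge0 \<open>a1 > 0\<close> by auto
          moreover have "x1 \<le> 1"
            using p_bound[OF top(5)] dual by (simp add: inner_add_right)
          ultimately show False using True by simp
        qed
      qed
      then consider "\<beta> = \<beta>'" | "a1 = 0" "\<beta> \<noteq> \<beta>'" by blast
      then have "\<beta> = \<beta>'"
      proof cases
        case 2
        then have "\<beta> * a2 = \<beta>' * a2" "a2 \<noteq> 0" using au aw h by auto
        then show ?thesis by simp
      qed
      then show ?thesis using diff shrink_in[OF frame_in(1), of "\<alpha> - \<alpha>'"] le1 ge0 order
        by (simp add: c)
    next
      case right: False
      define x y where "x = \<alpha> - \<alpha>'" "y = \<beta>' - \<beta>"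
      have xy: "0 \<le> x" "x \<le> - x0" "x \<le> 1" "0 \<le> y" "y \<le> 1"
        using right False le1 ge0 order top by (auto simp: x_y_def c)
      have ends: "- f \<in> K" "(- x0) *\<^sub>R e - f \<in> K"
        using frame_in(2) top(4) uminus_in[of "x0 *\<^sub>R e + f"] by (auto simp del: uminus_in simp: uminus_in[of f])
      have "x *\<^sub>R e - f \<in> K"
      proof (cases "x0 = 0")
        case True
        then show ?thesis using xy ends by simp
      next
        case False
        define t where "t = x / (- x0)"
        have t: "0 \<le> t" "t \<le> 1" "t * x0 = - x"
          using xy top(1) False by (auto simp: t_def field_simps)
        have "(1 - t) *\<^sub>R (- f) + t *\<^sub>R ((- x0) *\<^sub>R e - f) \<in> K"
          using convexD[OF convex_K ends(1,2), of "1 - t" t] t by simp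
        also have "(1 - t) *\<^sub>R (- f) + t *\<^sub>R ((- x0) *\<^sub>R e - f) = x *\<^sub>R e - f"
          using t by (simp add: algebra_simps) 
        finally show ?thesis .
      qed
      moreover have "x *\<^sub>R e \<in> K" using shrink_in[OF frame_in(1), of x] xy by simp
      ultimately have "y *\<^sub>R (x *\<^sub>R e - f) + (1 - y) *\<^sub>R (x *\<^sub>R e) \<in> K"
        using convexD[OF convex_K, of "x *\<^sub>R e - f" "x *\<^sub>R e" y "1 - y"] xy by simp
      also have "y *\<^sub>R (x *\<^sub>R e - f) + (1 - y) *\<^sub>R (x *\<^sub>R e) = u - w"
        by (simp add: diff x_y_def algebra_simps)
      finally show ?thesis .
    qed
  qed
qed

text \<open>Reversing one or both axes carries every quadrant to the first.\<close>

lemma common_face_diff_in: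
  assumes top: "x0 \<le> 0" "0 \<le> x1" "1 \<le> x1 - x0" "x0 *\<^sub>R e + f \<in> K" "x1 *\<^sub>R e + f \<in> K"
    and face: "supports a u" "supports a w"
    and quadrant: "0 \<le> (p \<bullet> u) * (p \<bullet> w)" "0 \<le> (q \<bullet> u) * (q \<bullet> w)"
  shows "u - w \<in> K"
proof -
  have quadrant1: "u - w \<in> K"
    if "conjugate_frame K e f p q" and "0 \<le> p \<bullet> u" "0 \<le> q \<bullet> u" "0 \<le> p \<bullet> w" "0 \<le> q \<bullet> w"
      "x0 \<le> 0" "0 \<le> x1" "1 \<le> x1 - x0" "x0 *\<^sub>R e + f \<in> K" "x1 *\<^sub>R e + f \<in> K"
    for e f p q x0 x1
  proof (cases "p \<bullet> w \<le> p \<bullet> u")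
    case True
    then show ?thesis
      using conjugate_frame.common_face_diff_in_quadrant[OF that(1,6-10) face] that by blast
  next
    case False
    then have "w - u \<in> K"
      using conjugate_frame.common_face_diff_in_quadrant[OF that(1,6-10) face(2,1)] that by simp
    then show ?thesis using uminus_in[of "w - u"] by simp
  qed
  have frames: "conjugate_frame K e f p q" "conjugate_frame K (- e) f (- p) q"
    "conjugate_frame K e (- f) p (- q)" "conjugate_frame K (- e) (- f) (- p) (- q)"
    using frame_in dual p_bound q_bound by unfold_locales auto
  have flipped: "- (x0 *\<^sub>R e) - f \<in> K" "- (x1 *\<^sub>R e) - f \<in> K"
    using top(4,5) by (metis add_uminus_conv_diff minus_add_distrib uminus_in)+
  have "(0 \<le> p \<bullet> u \<and> 0 \<le> p \<bullet> w) \<or> (p \<bullet> u \<le> 0 \<and> p \<bullet> w \<le> 0)"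
    "(0 \<le> q \<bullet> u \<and> 0 \<le> q \<bullet> w) \<or> (q \<bullet> u \<le> 0 \<and> q \<bullet> w \<le> 0)"
    using quadrant by (auto simp: zero_le_mult_iff)
  then consider
    "0 \<le> p \<bullet> u" "0 \<le> p \<bullet> w" "0 \<le> q \<bullet> u" "0 \<le> q \<bullet> w" |
    "p \<bullet> u \<le> 0" "p \<bullet> w \<le> 0" "0 \<le> q \<bullet> u" "0 \<le> q \<bullet> w" |
    "0 \<le> p \<bullet> u" "0 \<le> p \<bullet> w" "q \<bullet> u \<le> 0" "q \<bullet> w \<le> 0" |
    "p \<bullet> u \<le> 0" "p \<bullet> w \<le> 0" "q \<bullet> u \<le> 0" "q \<bullet> w \<le> 0" by blast
  then show ?thesis
  proof cases
    case 1 then show ?thesis by (intro quadrant1[OF frames(1), of x0 x1]) (use top in auto)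
  next
    case 2 then show ?thesis by (intro quadrant1[OF frames(2), of "- x1" "- x0"]) (use top in auto)
  next
    case 3 then show ?thesis
      by (intro quadrant1[OF frames(3), of "- x1" "- x0"]) (use top flipped in auto)
  next
    case 4 then show ?thesis
      by (intro quadrant1[OF frames(4), of x0 x1]) (use top flipped in auto)
  qed
qed

text \<open>Since \<open>K\<close> is the unit ball, \<open>u - w \<in> K\<close> bounds the length of a face within a quadrant by one.\<close>

definition short_faces :: bool where
  "short_faces \<longleftrightarrow> (\<forall>a u w. supports a u \<and> supports a w \<and>
     0 \<le> (p \<bullet> u) * (p \<bullet> w) \<and> 0 \<le> (q \<bullet> u) * (q \<bullet> w) \<longrightarrow> u - w \<in> K)"

end

context symmetric_body
begin

text \<open>Two vectors of \<open>K\<close> that span a parallelogram of maximal area are conjugate: replacing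
  one of them by another point of \<open>K\<close> multiplies the area by a coordinate of that point.\<close>

lemma conjugate_frame_exists: "\<exists>e f p q. conjugate_frame K e f p q"
proof -
  define det :: "plane \<Rightarrow> plane \<Rightarrow> real" where "det = (\<lambda>u v. u $ 1 * v $ 2 - u $ 2 * v $ 1)"
  have "continuous_on (K \<times> K) (\<lambda>x. det (fst x) (snd x))"
    unfolding det_def by (intro continuous_intros)
  then have "\<exists>x\<in>K \<times> K. \<forall>y\<in>K \<times> K. det (fst y) (snd y) \<le> det (fst x) (snd x)"
    using zero_in by (intro continuous_attains_sup compact_Times compact_K) auto
  then obtain e f where ef: "e \<in> K" "f \<in> K" and max: "\<And>u v. u \<in> K \<Longrightarrow> v \<in> K \<Longrightarrow> det u v \<le> det e f"
    by auto
  obtain r where r: "r > 0" "ball 0 r \<subseteq> K"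
    using zero_interior mem_interior by blast
  have "axis i (r / 2) \<in> ball 0 r" for i :: 2
    using r by (simp add: norm_eq_sqrt_inner inner_axis_axis real_sqrt_divide)
  then have axes: "axis i (r / 2) \<in> K" for i :: 2 using r by blast
  have "0 < det (axis 1 (r / 2)) (axis 2 (r / 2))"
    using r by (simp add: det_def axis_def)
  also have "\<dots> \<le> det e f" by (intro max axes)
  finally have D: "0 < det e f" .
  have det: "det u v = u $ 1 * v $ 2 - u $ 2 * v $ 1" for u v by (simp add: det_def)
  define p :: plane where "p = vector [f $ 2 / det e f, - (f $ 1) / det e f]"
  define q :: plane where "q = vector [- (e $ 2) / det e f, e $ 1 / det e f]"
  have p: "p \<bullet> k = det k f / det e f" for k
    using D by (simp add: p_def inner_plane det[of k f] field_simps)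
  have q: "q \<bullet> k = det e k / det e f" for k
    using D by (simp add: q_def inner_plane det[of e k] field_simps)
  have neg: "det (- u) v = - det u v" "det u (- v) = - det u v" for u v
    by (simp_all add: det_def)
  have "conjugate_frame K e f p q"
  proof unfold_locales
    show "p \<bullet> e = 1" "p \<bullet> f = 0" "q \<bullet> e = 0" "q \<bullet> f = 1"
      using D unfolding p q by (simp_all add: det_def)
    show "\<bar>p \<bullet> k\<bar> \<le> 1" "\<bar>q \<bullet> k\<bar> \<le> 1" if "k \<in> K" for k
      using D max[of k f] max[of "- k" f] max[of e k] max[of e "- k"] that ef
      unfolding p q by (auto simp: neg abs_le_iff)
  qed (use ef in auto)
  then show ?thesis by blast
qed

text \<open>Let \<open>e\<close> be the unit vector along a long segment. A supporting functional \<open>p\<close> at \<open>e\<close> changes by more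
  than one along the segment and is bounded by one in absolute value, so it changes its sign there, and
  the zero can serve as \<open>f\<close>.\<close>

lemma long_face_frame_exists:
  assumes segment: "closed_segment c d \<subseteq> frontier K" and long: "d - c \<notin> K"
  shows "\<exists>e f p q. conjugate_frame K e f p q \<and> conjugate_frame.short_faces K p q"
proof -
  have cd: "c \<in> K" "d \<in> K" "midpoint c d \<in> frontier K"
    using segment frontier_iff by (auto simp: subset_iff)
  obtain b where b: "supports b (midpoint c d)" using supports_exists[OF cd(3)] .
  have m: "b \<bullet> midpoint c d = (b \<bullet> c + b \<bullet> d) / 2"
    by (simp add: midpoint_def inner_add_right)
  have "x = z \<and> y = z" if "x \<le> z" "y \<le> z" "z = (x + y) / 2" for x y z :: real
    using that by auto
  then have bcd: "b \<bullet> c = b \<bullet> midpoint c d" "b \<bullet> d = b \<bullet> midpoint c d"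
    using supportsD(3)[OF b cd(1)] supportsD(3)[OF b cd(2)] m by blast+
  define h where "h = b \<bullet> midpoint c d"
  have h: "0 < h" using supports_pos[OF b] by (simp add: h_def)
  define q where "q = (1 / h) *\<^sub>R b"
  have qcd: "q \<bullet> c = 1" "q \<bullet> d = 1" using h bcd by (auto simp: q_def h_def)
  have "d - c \<noteq> 0" using long zero_in by auto
  then obtain t where t: "0 < t" "0 + t *\<^sub>R (d - c) \<in> frontier K"
    using ray_to_frontier[of K 0 "d - c"] compact_K zero_interior compact_imp_bounded by metis
  define e where "e = t *\<^sub>R (d - c)"
  have e: "e \<in> frontier K" using t by (simp add: e_def)
  have t1: "t < 1"
  proof (rule ccontr)
    assume "\<not> t < 1"
    then have "(1 / t) *\<^sub>R e \<in> K" using e frontier_iff t by (intro shrink_in) auto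
    then show False using long t by (simp add: e_def)
  qed
  obtain g where g: "supports g e" using supports_exists[OF e] .
  define p where "p = (1 / (g \<bullet> e)) *\<^sub>R g"
  have ge: "0 < g \<bullet> e" by (rule supports_pos[OF g])
  have pe: "p \<bullet> e = 1" using ge by (simp add: p_def)
  have p_bound: "\<bar>p \<bullet> k\<bar> \<le> 1" if "k \<in> K" for k
    using supportsD(3,4)[OF g that] ge by (simp add: p_def abs_le_iff field_simps)
  have q_bound: "\<bar>q \<bullet> k\<bar> \<le> 1" if "k \<in> K" for k
    using supportsD(3,4)[OF b that] h by (simp add: q_def h_def[symmetric] abs_le_iff field_simps)
  define f where "f = c - (p \<bullet> c) *\<^sub>R e"
  define x0 x1 where "x0 = p \<bullet> c" "x1 = p \<bullet> d"
  have "t * (x1 - x0) = 1" using pe by (simp add: e_def x0_x1_def inner_diff_right)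
  then have len: "x1 - x0 = 1 / t" using t by (simp add: field_simps)
  then have "1 < x1 - x0" using t t1 by simp
  moreover have "\<bar>x0\<bar> \<le> 1" "\<bar>x1\<bar> \<le> 1" using p_bound cd by (auto simp: x0_x1_def)
  ultimately have x: "x0 \<le> 0" "0 \<le> x1" "1 \<le> x1 - x0" by linarith+
  have c: "c = x0 *\<^sub>R e + f" by (simp add: f_def x0_x1_def)
  have "d = c + (1 / t) *\<^sub>R e" using t by (simp add: e_def)
  then have d: "d = x1 *\<^sub>R e + f"
    using len by (simp add: f_def x0_x1_def algebra_simps)
  define s where "s = x1 / (x1 - x0)"
  have s: "0 \<le> s" "s \<le> 1" using x by (auto simp: s_def field_simps)
  have "s *\<^sub>R c + (1 - s) *\<^sub>R d \<in> K"
    using convexD[OF convex_K cd(1,2), of s "1 - s"] s by simp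
  also have "s *\<^sub>R c + (1 - s) *\<^sub>R d = (s * x0 + (1 - s) * x1) *\<^sub>R e + f"
    unfolding c d by (simp add: algebra_simps)
  also have "s * x0 + (1 - s) * x1 = 0"
    using x by (simp add: s_def field_simps)
  finally have "f \<in> K" by simp
  have "e \<in> K" using e frontier_iff by blast
  have qe: "q \<bullet> e = 0" using qcd by (simp add: e_def inner_diff_right)
  interpret conjugate_frame K e f p q
  proof unfold_locales
    show "p \<bullet> f = 0" "q \<bullet> f = 1" using pe qe qcd by (simp_all add: f_def inner_diff_right)
  qed (use \<open>e \<in> K\<close> \<open>f \<in> K\<close> pe qe p_bound q_bound in auto)
  have short_faces
    unfolding short_faces_def using common_face_diff_in[OF x] cd(1,2) c d by metis
  then show ?thesis using conjugate_frame_axioms by blast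
qed

lemma short_faces_frame_exists:
  "\<exists>e f p q. conjugate_frame K e f p q \<and> conjugate_frame.short_faces K p q"
proof (cases "\<exists>c d. closed_segment c d \<subseteq> frontier K \<and> d - c \<notin> K")
  case True
  then show ?thesis using long_face_frame_exists by blast
next
  case False
  obtain e f p q where frame: "conjugate_frame K e f p q" using conjugate_frame_exists by blast
  have "u - w \<in> K" if "supports a u" "supports a w" for a u w
    using common_face_segment[OF that(2,1)] False by blast
  then have "conjugate_frame.short_faces K p q"
    using conjugate_frame.short_faces_def[OF frame] by blast
  then show ?thesis using frame by blast
qed

end

section \<open>Neighbours of one translate\<close>

text \<open>Coordinates are those of a conjugate frame, reflected so that the two points lie in the first
  quadrant, and \<open>s\<close>, \<open>t\<close> are the values at \<open>e\<close> and \<open>f\<close> of a supporting functional at \<open>(x, y)\<close>. To be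
  nonpositive at another point of the quadrant, the functional must have coefficients of different signs
  or a vanishing one; as its maximum is also at least its value at the ends of the axes, it can then only
  be attained on the boundary of the unit square.\<close>

lemma support_in_square:
  fixes x y x' y' s t h :: real
  assumes "0 \<le> x" "x \<le> 1" "0 \<le> y" "y \<le> 1" "0 \<le> x'" "0 \<le> y'" "x' \<noteq> 0 \<or> y' \<noteq> 0"
    and h: "h = x * s + y * t" "0 < h" "\<bar>s\<bar> \<le> h" "\<bar>t\<bar> \<le> h"
    and "x' * s + y' * t \<le> 0"
  shows "(x = 1 \<and> y = 0 \<and> 0 < s \<and> t < 0) \<or> (x = 0 \<and> y = 1 \<and> s < 0 \<and> 0 < t) \<or>
    (x = 1 \<and> 0 < s \<and> t = 0 \<and> x' = 0) \<or> (y = 1 \<and> s = 0 \<and> 0 < t \<and> y' = 0)"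
proof -
  have *: "(x = 1 \<and> y = 0 \<and> 0 < s \<and> t < 0) \<or> (x = 1 \<and> 0 < s \<and> t = 0 \<and> x' = 0)"
    if "0 < s" "t \<le> 0" "0 \<le> x" "x \<le> 1" "0 \<le> y" "0 \<le> x'" "0 \<le> y'" "h = x * s + y * t" "\<bar>s\<bar> \<le> h"
      "x' * s + y' * t \<le> 0"
    for x y x' y' s t :: real
  proof -
    have 1: "x * s \<le> s" "y * t \<le> 0" using that by (auto simp: mult_le_0_iff)
    then have "x * s = s" "y * t = 0" using that by linarith+
    then have "x = 1" "y = 0 \<or> t = 0" using that by auto
    moreover have "x' = 0" if "t = 0"
      using that \<open>0 < s\<close> \<open>0 \<le> x'\<close> \<open>x' * s + y' * t \<le> 0\<close> by (simp add: mult_le_0_iff)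
    ultimately show ?thesis using that by force
  qed
  have "\<not> (s \<le> 0 \<and> t \<le> 0)"
  proof
    assume "s \<le> 0 \<and> t \<le> 0"
    then have "x * s \<le> 0" "y * t \<le> 0" using assms by (auto simp: mult_le_0_iff)
    then show False using h by linarith
  qed
  moreover have "\<not> (0 < s \<and> 0 < t)"
  proof
    assume st: "0 < s \<and> 0 < t"
    then have "0 \<le> x' * s" "0 \<le> y' * t" using assms by auto
    then have "x' * s = 0" "y' * t = 0" using assms(12) by linarith+
    then show False using assms(7) st by auto
  qed
  ultimately consider "0 < s" "t \<le> 0" | "0 < t" "s \<le> 0" by linarith
  then show ?thesis
  proof cases
    case 1
    then show ?thesis using *[of s t x y x' y'] assms by auto
  next
    case 2
    then show ?thesis using *[of t s y x y' x'] assms by (auto simp: add.commute)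
  qed
qed

text \<open>If each of two points of a closed quadrant is on the nonpositive side of a supporting functional at
  the other, then one of them is the end of an axis and its functional is negative at the end of the other
  axis, or they are the ends of the two axes and each functional vanishes on the other axis. These are exactly the configurations that
  the assignment of the axis directions to the two colours has to exclude.\<close>

lemma crossing_supports_in_square:
  fixes x y x' y' s t s' t' :: real
  assumes "0 \<le> x" "x \<le> 1" "0 \<le> y" "y \<le> 1" "0 \<le> x'" "x' \<le> 1" "0 \<le> y'" "y' \<le> 1"
    and h: "h = x * s + y * t" "0 < h" "\<bar>s\<bar> \<le> h" "\<bar>t\<bar> \<le> h"
    and h': "h' = x' * s' + y' * t'" "0 < h'" "\<bar>s'\<bar> \<le> h'" "\<bar>t'\<bar> \<le> h'"
    and "x' * s + y' * t \<le> 0" "x * s' + y * t' \<le> 0"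
  shows "(x = 1 \<and> y = 0 \<and> 0 < s \<and> t < 0) \<or> (x = 0 \<and> y = 1 \<and> s < 0 \<and> 0 < t) \<or>
    (x' = 1 \<and> y' = 0 \<and> 0 < s' \<and> t' < 0) \<or> (x' = 0 \<and> y' = 1 \<and> s' < 0 \<and> 0 < t') \<or>
    (x = 1 \<and> y = 0 \<and> t = 0 \<and> x' = 0 \<and> y' = 1 \<and> s' = 0) \<or>
    (x = 0 \<and> y = 1 \<and> s = 0 \<and> x' = 1 \<and> y' = 0 \<and> t' = 0)"
proof -
  have "x' \<noteq> 0 \<or> y' \<noteq> 0" "x \<noteq> 0 \<or> y \<noteq> 0" using h h' by auto
  then show ?thesis
    using support_in_square[OF assms(1-5,7) _ h assms(17)]
      support_in_square[OF assms(5-8,1,3) _ h' assms(18)] by argo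
qed

text \<open>Here \<open>(k, l)\<close> are the coordinates of a contact direction, and \<open>m\<close>, \<open>n\<close> are the values of the normal
  at \<open>e\<close> and \<open>f\<close>. The signs \<open>\<sigma>\<close> and \<open>\<tau>\<close> name a closed quadrant; its interior has the first colour if
  they agree. The colour of an axis direction is that of the adjacent quadrant between two directions on
  which the normal is positive; if the normal vanishes on the other axis, the two axes get different
  colours.\<close>

lemma tilt_decides_color:
  fixes \<sigma> \<tau> k l m n :: real
  assumes signs: "\<sigma> = 1 \<or> \<sigma> = -1" "\<tau> = 1 \<or> \<tau> = -1"
    and color: "(0 < k * l \<or> l = 0 \<and> 0 \<le> m * n \<or> k = 0 \<and> 0 < m * n) \<longleftrightarrow> \<sigma> = \<tau>"
  shows "\<not> (\<sigma> * k = 1 \<and> \<tau> * l = 0 \<and> 0 < \<sigma> * m \<and> \<tau> * n < 0)"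
    and "\<not> (\<sigma> * k = 0 \<and> \<tau> * l = 1 \<and> \<sigma> * m < 0 \<and> 0 < \<tau> * n)"
    and "\<sigma> * k = 1 \<and> \<tau> * l = 0 \<and> \<tau> * n = 0 \<Longrightarrow> \<sigma> = \<tau>"
    and "\<sigma> * k = 0 \<and> \<tau> * l = 1 \<and> \<sigma> * m = 0 \<Longrightarrow> \<sigma> \<noteq> \<tau>"
proof -
  have mn: "m * n = (if \<sigma> = \<tau> then (\<sigma> * m) * (\<tau> * n) else - ((\<sigma> * m) * (\<tau> * n)))"
    using signs by auto
  have nz: "\<sigma> \<noteq> 0" "\<tau> \<noteq> 0" using signs by auto
  show "\<not> (\<sigma> * k = 1 \<and> \<tau> * l = 0 \<and> 0 < \<sigma> * m \<and> \<tau> * n < 0)"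
  proof
    assume A: "\<sigma> * k = 1 \<and> \<tau> * l = 0 \<and> 0 < \<sigma> * m \<and> \<tau> * n < 0"
    then have "l = 0" "k \<noteq> 0" "(\<sigma> * m) * (\<tau> * n) < 0" using nz by (auto intro: mult_pos_neg)
    then show False using color mn by (cases "\<sigma> = \<tau>") auto
  qed
  show "\<not> (\<sigma> * k = 0 \<and> \<tau> * l = 1 \<and> \<sigma> * m < 0 \<and> 0 < \<tau> * n)"
  proof
    assume A: "\<sigma> * k = 0 \<and> \<tau> * l = 1 \<and> \<sigma> * m < 0 \<and> 0 < \<tau> * n"
    then have "k = 0" "l \<noteq> 0" "(\<sigma> * m) * (\<tau> * n) < 0" using nz by (auto intro: mult_neg_pos)
    then show False using color mn by (cases "\<sigma> = \<tau>") auto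
  qed
  show "\<sigma> = \<tau>" if "\<sigma> * k = 1 \<and> \<tau> * l = 0 \<and> \<tau> * n = 0" using that color nz by auto
  show "\<sigma> \<noteq> \<tau>" if "\<sigma> * k = 0 \<and> \<tau> * l = 1 \<and> \<sigma> * m = 0" using that color nz by auto
qed

context symmetric_body
begin

text \<open>Whenever \<open>x + K\<close> and \<open>y + K\<close> touch, a line that separates them passes through the midpoint of \<open>x\<close>
  and \<open>y\<close>. That it supports both translates and avoids the interior of \<open>z + K\<close> is expressed here without
  fixing the orientation of \<open>a\<close>, so that the condition is symmetric in \<open>x\<close> and \<open>y\<close>.\<close>

definition separating_normal :: "plane set \<Rightarrow> plane \<Rightarrow> plane \<Rightarrow> plane \<Rightarrow> bool" where
  "separating_normal X x y a \<longleftrightarrow> a \<noteq> 0 \<and> (\<forall>k\<in>K. 2 * (a \<bullet> k) \<le> \<bar>a \<bullet> (y - x)\<bar>) \<and>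
     (\<forall>z\<in>X. \<bar>a \<bullet> (y - x)\<bar> \<le> \<bar>a \<bullet> (z - x) + a \<bullet> (z - y)\<bar>)"

lemma separating_normal_commute: "separating_normal X x y = separating_normal X y x"
  by (auto simp: separating_normal_def fun_eq_iff add.commute abs_minus_commute inner_diff_right)

end

text \<open>\<open>X\<close> is the set of centres, and \<open>N\<close> chooses for each contact the normal of a line as in the definition
  of total separability. The same normal is used for both directions of a contact.\<close>

locale separated_packing = conjugate_frame +
  fixes X :: "plane set" and N :: "plane \<Rightarrow> plane \<Rightarrow> plane"
  assumes no_hexagon: "\<not> quasi_hexagon K" and short: short_faces
    and apart: "\<And>x y. x \<in> X \<Longrightarrow> y \<in> X \<Longrightarrow> x \<noteq> y \<Longrightarrow> (1/2) *\<^sub>R (y - x) \<notin> interior K"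
    and normal: "\<And>x y. x \<in> X \<Longrightarrow> y \<in> X \<Longrightarrow> x \<noteq> y \<Longrightarrow> (1/2) *\<^sub>R (y - x) \<in> K \<Longrightarrow>
       separating_normal X x y (N x y)"
    and N_commute: "\<And>x y. N x y = N y x"
begin

definition contact :: "plane \<Rightarrow> plane \<Rightarrow> bool" where
  "contact x y \<longleftrightarrow> x \<in> X \<and> y \<in> X \<and> x \<noteq> y \<and> (1/2) *\<^sub>R (y - x) \<in> K"

lemma contact_commute: "contact x y \<longleftrightarrow> contact y x"
  using uminus_in[of "(1/2) *\<^sub>R (y - x)"]
  by (auto simp: contact_def simp del: uminus_in simp flip: scaleR_minus_right)

text \<open>In this orientation, the line between \<open>x\<close> and \<open>y\<close> leaves every other centre \<open>z\<close> either on the side of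
  \<open>x\<close> or beyond \<open>y\<close>. For a neighbour \<open>z\<close> of \<open>x\<close> the first alternative says that the angle between the
  two contacts is at least right, and the second one forces both contacts into one face.\<close>

lemma contact_support:
  assumes "contact x y"
  obtains a where "a = N x y \<or> a = - N x y" "supports a ((1/2) *\<^sub>R (y - x))"
    "\<And>z. z \<in> X \<Longrightarrow> a \<bullet> (z - x) \<le> 0 \<or> a \<bullet> (y - x) \<le> a \<bullet> (z - x)"
proof -
  have sep: "separating_normal X x y (N x y)" using assms normal by (simp add: contact_def)
  define a where "a = (if 0 \<le> N x y \<bullet> (y - x) then N x y else - N x y)"
  have a: "a \<noteq> 0" "\<bar>N x y \<bullet> (y - x)\<bar> = a \<bullet> (y - x)" "0 \<le> a \<bullet> (y - x)"
    using sep by (auto simp: a_def separating_normal_def)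
  have bound: "2 * (a \<bullet> k) \<le> a \<bullet> (y - x)" if "k \<in> K" for k
    using sep that uminus_in[of k] unfolding separating_normal_def a(2)
    by (auto simp: a_def simp del: uminus_in)
  have "a \<bullet> k \<le> a \<bullet> ((1/2) *\<^sub>R (y - x))" if "k \<in> K" for k
    using bound[OF that] by simp
  then have "supports a ((1/2) *\<^sub>R (y - x))"
    using assms a(1) unfolding supports_def contact_def by blast
  moreover have "a \<bullet> (z - x) \<le> 0 \<or> a \<bullet> (y - x) \<le> a \<bullet> (z - x)" if "z \<in> X" for z
  proof -
    have "a \<bullet> (y - x) \<le> \<bar>N x y \<bullet> (z - x) + N x y \<bullet> (z - y)\<bar>"
      using sep that unfolding separating_normal_def a(2) by blast
    also have "\<dots> = \<bar>a \<bullet> (z - x) + a \<bullet> (z - y)\<bar>" by (auto simp: a_def)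
    also have "a \<bullet> (z - y) = a \<bullet> (z - x) - a \<bullet> (y - x)" by (simp add: inner_diff_right)
    finally show ?thesis using a(3) by linarith
  qed
  ultimately show thesis using that[of a] by (auto simp: a_def)
qed

text \<open>Within a quadrant, two neighbours of \<open>x\<close> beyond the same face are so close that they touch. The line
  between them must avoid \<open>x + K\<close>, which puts half of their difference into a common face with one of the two
  contact directions. Together with the given face it makes \<open>K\<close> a quasi hexagon.\<close>

lemma contacts_no_common_face:
  assumes "contact x y" "contact x z" "y \<noteq> z"
    and face: "supports a ((1/2) *\<^sub>R (y - x))" "supports a ((1/2) *\<^sub>R (z - x))"
    and quadrant: "0 \<le> (p \<bullet> (y - x)) * (p \<bullet> (z - x))" "0 \<le> (q \<bullet> (y - x)) * (q \<bullet> (z - x))"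
  shows False
proof -
  define u w where "u = (1/2) *\<^sub>R (y - x)" "w = (1/2) *\<^sub>R (z - x)"
  have yz: "(1/2) *\<^sub>R (z - y) = w - u" "(1/2) *\<^sub>R (y - z) = u - w"
    by (simp_all add: u_w_def flip: scaleR_diff_right)
  have X: "x \<in> X" "y \<in> X" "z \<in> X" using assms(1,2) by (auto simp: contact_def)
  have "w - u \<in> K"
  proof -
    have "0 \<le> (p \<bullet> w) * (p \<bullet> u)" "0 \<le> (q \<bullet> w) * (q \<bullet> u)"
      using quadrant by (simp_all add: u_w_def mult.commute)
    then show ?thesis using short face unfolding short_faces_def u_w_def by blast
  qed
  then have "contact y z" using X assms(3) yz by (simp add: contact_def)
  then obtain b where b: "supports b (w - u)"
    "b \<bullet> (x - y) \<le> 0 \<or> b \<bullet> (z - y) \<le> b \<bullet> (x - y)"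
    using contact_support[of y z] X yz by metis
  have "x - y = (-2) *\<^sub>R u" "z - y = 2 *\<^sub>R (w - u)"
    by (simp_all add: u_w_def algebra_simps)
  then have cases: "0 \<le> b \<bullet> u \<or> b \<bullet> w \<le> 0"
    using b(2) by (auto simp: inner_diff_right)
  have u: "u \<in> K" "w \<in> K" using face supportsD(2) by (auto simp: u_w_def)
  have apart': "u - w \<notin> interior K" "w - u \<notin> interior K"
    using apart[OF X(2,3)] apart[OF X(3,2)] assms(3) yz by auto
  have bw: "b \<bullet> w \<le> b \<bullet> (w - u)" "- (b \<bullet> (w - u)) \<le> b \<bullet> u"
    using supportsD(3)[OF b(1) u(2)] supportsD(4)[OF b(1) u(1)] by auto
  from cases show False
  proof
    assume "0 \<le> b \<bullet> u"
    then have "b \<bullet> w = b \<bullet> (w - u)" using bw by (simp add: inner_diff_right)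
    then have "supports b w" using b(1) u by (simp add: supports_def)
    then show False
      using quasi_hexagonI[OF _ _ apart'(2) _ b(1), of a] face no_hexagon by (simp add: u_w_def)
  next
    assume "b \<bullet> w \<le> 0"
    then have "b \<bullet> u = - (b \<bullet> (w - u))" using bw by (simp add: inner_diff_right)
    then have "supports (- b) u" using supportsD[OF b(1)] u by (auto simp: supports_def) (metis minus_le_iff)
    moreover have "supports (- b) (u - w)" using supports_uminus[OF b(1)] by simp
    ultimately show False
      using quasi_hexagonI[OF _ _ apart'(1)] face no_hexagon u_w_def by metis
  qed
qed

text \<open>The colour of a contact: the first and third quadrants are horizontal, the second and fourth
  vertical. A direction on an axis goes to the adjacent quadrant towards which the normal tilts, which is
  where the line leaves no room for a second neighbour.\<close>

definition horizontal :: "plane \<Rightarrow> plane \<Rightarrow> bool" where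
  "horizontal x y \<longleftrightarrow> 0 < (p \<bullet> (y - x)) * (q \<bullet> (y - x)) \<or>
     q \<bullet> (y - x) = 0 \<and> 0 \<le> (N x y \<bullet> e) * (N x y \<bullet> f) \<or>
     p \<bullet> (y - x) = 0 \<and> 0 < (N x y \<bullet> e) * (N x y \<bullet> f)"

lemma horizontal_commute: "horizontal x y = horizontal y x"
proof -
  have "p \<bullet> (y - x) = - (p \<bullet> (x - y))" "q \<bullet> (y - x) = - (q \<bullet> (x - y))"
    by (simp_all add: inner_diff_right)
  then show ?thesis unfolding horizontal_def N_commute[of y x] by auto
qed

text \<open>For a smooth body this is the statement that angles between contacts are at least right. Distinct
  neighbours in one quadrant cannot share a face, hence are on the nonpositive sides of the lines of each
  other; the few remaining positions on the axes have different colours.\<close>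

lemma one_contact_per_quadrant:
  assumes "contact x y" "contact x z"
    and signs: "\<sigma> = 1 \<or> \<sigma> = -1" "\<tau> = 1 \<or> \<tau> = -1"
    and quadrant: "0 \<le> \<sigma> * (p \<bullet> (y - x))" "0 \<le> \<tau> * (q \<bullet> (y - x))"
      "0 \<le> \<sigma> * (p \<bullet> (z - x))" "0 \<le> \<tau> * (q \<bullet> (z - x))"
    and color: "horizontal x y \<longleftrightarrow> \<sigma> = \<tau>" "horizontal x z \<longleftrightarrow> \<sigma> = (\<tau> :: real)"
  shows "y = z"
proof (rule ccontr)
  assume "y \<noteq> z"
  define u w where "u = (1/2) *\<^sub>R (y - x)" "w = (1/2) *\<^sub>R (z - x)"
  have same: "0 \<le> (p \<bullet> (y - x)) * (p \<bullet> (z - x))" "0 \<le> (q \<bullet> (y - x)) * (q \<bullet> (z - x))"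
    using signs quadrant by (auto simp: zero_le_mult_iff)
  obtain a where a: "a = N x y \<or> a = - N x y" "supports a u"
    "a \<bullet> (z - x) \<le> 0 \<or> a \<bullet> (y - x) \<le> a \<bullet> (z - x)"
    using contact_support[OF assms(1)] assms(2) unfolding contact_def u_w_def by metis
  obtain b where b: "b = N x z \<or> b = - N x z" "supports b w"
    "b \<bullet> (y - x) \<le> 0 \<or> b \<bullet> (z - x) \<le> b \<bullet> (y - x)"
    using contact_support[OF assms(2)] assms(1) unfolding contact_def u_w_def by metis
  have K: "u \<in> K" "w \<in> K" using a b supportsD(2) by auto
  have au: "a \<bullet> w \<le> 0"
  proof (rule ccontr)
    assume "\<not> a \<bullet> w \<le> 0"
    then have "a \<bullet> u \<le> a \<bullet> w" using a(3) by (auto simp: u_w_def)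
    then have "supports a w" using a(2) K by (auto simp: supports_def)
    then show False
      using contacts_no_common_face[OF assms(1,2) \<open>y \<noteq> z\<close> _ _ same] a(2) u_w_def by metis
  qed
  have bw: "b \<bullet> u \<le> 0"
  proof (rule ccontr)
    assume "\<not> b \<bullet> u \<le> 0"
    then have "b \<bullet> w \<le> b \<bullet> u" using b(3) by (auto simp: u_w_def)
    then have "supports b u" using b(2) K by (auto simp: supports_def)
    then show False
      using contacts_no_common_face[OF assms(1,2) \<open>y \<noteq> z\<close> _ _ same] b(2) u_w_def by metis
  qed
  define x1 y1 x2 y2 s t s' t' where
    "x1 = \<sigma> * (p \<bullet> u)" "y1 = \<tau> * (q \<bullet> u)" "x2 = \<sigma> * (p \<bullet> w)" "y2 = \<tau> * (q \<bullet> w)"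
    "s = \<sigma> * (a \<bullet> e)" "t = \<tau> * (a \<bullet> f)" "s' = \<sigma> * (b \<bullet> e)" "t' = \<tau> * (b \<bullet> f)"
  note d = this
  have sq: "\<sigma> * \<sigma> = 1" "\<tau> * \<tau> = 1" using signs by auto
  have inner: "c \<bullet> v = (\<sigma> * (p \<bullet> v)) * (\<sigma> * (c \<bullet> e)) + (\<tau> * (q \<bullet> v)) * (\<tau> * (c \<bullet> f))" for c v
  proof -
    have "(\<sigma> * (p \<bullet> v)) * (\<sigma> * (c \<bullet> e)) + (\<tau> * (q \<bullet> v)) * (\<tau> * (c \<bullet> f))
      = (\<sigma> * \<sigma>) * ((p \<bullet> v) * (c \<bullet> e)) + (\<tau> * \<tau>) * ((q \<bullet> v) * (c \<bullet> f))" by simp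
    then show ?thesis using inner_coordinates[of c v] sq by simp
  qed
  have ge0: "0 \<le> x1" "0 \<le> y1" "0 \<le> x2" "0 \<le> y2"
    using quadrant by (auto simp: d u_w_def)
  have le1: "x1 \<le> 1" "y1 \<le> 1" "x2 \<le> 1" "y2 \<le> 1"
    using signs p_bound[OF K(1)] p_bound[OF K(2)] q_bound[OF K(1)] q_bound[OF K(2)]
    by (auto simp: d abs_le_iff)
  have abs: "\<bar>s\<bar> \<le> a \<bullet> u" "\<bar>t\<bar> \<le> a \<bullet> u" "\<bar>s'\<bar> \<le> b \<bullet> w" "\<bar>t'\<bar> \<le> b \<bullet> w"
    using signs supportsD(3,4)[OF a(2) frame_in(1)] supportsD(3,4)[OF a(2) frame_in(2)]
      supportsD(3,4)[OF b(2) frame_in(1)] supportsD(3,4)[OF b(2) frame_in(2)]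
    by (auto simp: d abs_le_iff)
  have inner': "a \<bullet> u = x1 * s + y1 * t" "b \<bullet> w = x2 * s' + y2 * t'"
    "x2 * s + y2 * t \<le> 0" "x1 * s' + y1 * t' \<le> 0"
    using au bw inner[of a u] inner[of b w] inner[of a w] inner[of b u] unfolding d by linarith+
  note crossing = crossing_supports_in_square[OF ge0(1) le1(1) ge0(2) le1(2) ge0(3) le1(3) ge0(4) le1(4)
    inner'(1) supports_pos[OF a(2)] abs(1,2) inner'(2) supports_pos[OF b(2)] abs(3,4) inner'(3,4)]
  have twice: "p \<bullet> (y - x) = 2 * (p \<bullet> u)" "q \<bullet> (y - x) = 2 * (q \<bullet> u)"
    "p \<bullet> (z - x) = 2 * (p \<bullet> w)" "q \<bullet> (z - x) = 2 * (q \<bullet> w)"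
    by (simp_all add: u_w_def)
  have pos: "0 < (2 * k) * (2 * l) \<longleftrightarrow> 0 < k * l" "2 * k = 0 \<longleftrightarrow> k = 0" for k l :: real
    by (simp_all add: zero_less_mult_iff)
  have "(N x y \<bullet> e) * (N x y \<bullet> f) = (a \<bullet> e) * (a \<bullet> f)" "(N x z \<bullet> e) * (N x z \<bullet> f) = (b \<bullet> e) * (b \<bullet> f)"
    using a(1) b(1) by auto
  then have color': "(0 < (p \<bullet> u) * (q \<bullet> u) \<or> q \<bullet> u = 0 \<and> 0 \<le> (a \<bullet> e) * (a \<bullet> f) \<or>
      p \<bullet> u = 0 \<and> 0 < (a \<bullet> e) * (a \<bullet> f)) \<longleftrightarrow> \<sigma> = \<tau>"
    "(0 < (p \<bullet> w) * (q \<bullet> w) \<or> q \<bullet> w = 0 \<and> 0 \<le> (b \<bullet> e) * (b \<bullet> f) \<or>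
      p \<bullet> w = 0 \<and> 0 < (b \<bullet> e) * (b \<bullet> f)) \<longleftrightarrow> \<sigma> = \<tau>"
    using color unfolding horizontal_def twice pos by simp_all
  note tie = tilt_decides_color[OF signs]
  show False
    using crossing tie(1,2)[OF color'(1)] tie(1,2)[OF color'(2)]
      tie(3)[OF color'(1)] tie(4)[OF color'(2)] tie(4)[OF color'(1)] tie(3)[OF color'(2)]
    unfolding d by argo
qed

end

section \<open>Contacts form two families of paths\<close>

text \<open>If a functional grows along a path but is equal at its ends, then the first step does not change it:
  a path between two points of an axis starts along the axis.\<close>

lemma trancl_first_step:
  fixes g h :: "'a :: real_inner"
  assumes "(x, z) \<in> R\<^sup>+" and "\<And>x y. (x, y) \<in> R \<Longrightarrow> 0 \<le> g \<bullet> (y - x) \<and> 0 \<le> h \<bullet> (y - x)"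
  shows "\<exists>y. (x, y) \<in> R \<and> 0 \<le> g \<bullet> (z - y) \<and> 0 \<le> h \<bullet> (z - y)"
  using assms(1)
proof induction
  case (base z)
  then show ?case by (intro exI[of _ z]) simp
next
  case (step z z')
  then obtain y where "(x, y) \<in> R" "0 \<le> g \<bullet> (z - y)" "0 \<le> h \<bullet> (z - y)" by blast
  then show ?case using assms(2)[OF step(2)]
    by (intro exI[of _ y]) (simp add: inner_diff_right)
qed

context separated_packing
begin

lemma contact_along_f:
  assumes "contact x y" "p \<bullet> (y - x) = 0" "0 \<le> q \<bullet> (y - x)"
  shows "y = x + 2 *\<^sub>R f"
proof -
  define s where "s = q \<bullet> ((1/2) *\<^sub>R (y - x))"
  have u: "(1/2) *\<^sub>R (y - x) \<in> K" "(1/2) *\<^sub>R (y - x) \<notin> interior K"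
    using assms(1) apart by (auto simp: contact_def)
  have eq: "(1/2) *\<^sub>R (y - x) = s *\<^sub>R f"
  proof -
    have "p \<bullet> ((1/2) *\<^sub>R (y - x)) = 0" using assms(2) by simp
    then show ?thesis unfolding s_def by (metis coordinates add_0 scaleR_zero_left)
  qed
  have "\<bar>s\<bar> \<le> 1" "0 \<le> s" using q_bound[OF u(1)] assms(3) by (simp_all add: s_def)
  moreover have "\<not> \<bar>s\<bar> < 1" using shrink_interior[OF frame_in(2), of s] u(2) eq by auto
  ultimately have "s = 1" by simp
  then have "(1/2) *\<^sub>R (y - x) = f" using eq by simp
  then have "y - x = 2 *\<^sub>R f" by (metis scaleR_half_double scaleR_2 scaleR_right_distrib)
  then show ?thesis by (simp add: algebra_simps)
qed

lemma contact_along_e: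
  assumes "contact x y" "q \<bullet> (y - x) = 0" "0 \<le> p \<bullet> (y - x)"
  shows "y = x + 2 *\<^sub>R e"
proof -
  define s where "s = p \<bullet> ((1/2) *\<^sub>R (y - x))"
  have u: "(1/2) *\<^sub>R (y - x) \<in> K" "(1/2) *\<^sub>R (y - x) \<notin> interior K"
    using assms(1) apart by (auto simp: contact_def)
  have eq: "(1/2) *\<^sub>R (y - x) = s *\<^sub>R e"
  proof -
    have "q \<bullet> ((1/2) *\<^sub>R (y - x)) = 0" using assms(2) by simp
    then show ?thesis unfolding s_def by (metis coordinates add_0_right scaleR_zero_left)
  qed
  have "\<bar>s\<bar> \<le> 1" "0 \<le> s" using p_bound[OF u(1)] assms(3) by (simp_all add: s_def)
  moreover have "\<not> \<bar>s\<bar> < 1" using shrink_interior[OF frame_in(1), of s] u(2) eq by auto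
  ultimately have "s = 1" by simp
  then have "(1/2) *\<^sub>R (y - x) = e" using eq by simp
  then have "y - x = 2 *\<^sub>R e" by (metis scaleR_half_double scaleR_2 scaleR_right_distrib)
  then show ?thesis by (simp add: algebra_simps)
qed

text \<open>Each contact is directed so that horizontal paths run into the first quadrant and vertical paths into
  the second.\<close>

definition horizontal_edges :: "(plane \<times> plane) set" where
  "horizontal_edges = {(x, y). contact x y \<and> horizontal x y \<and> 0 \<le> p \<bullet> (y - x) \<and> 0 \<le> q \<bullet> (y - x)}"

definition vertical_edges :: "(plane \<times> plane) set" where
  "vertical_edges = {(x, y). contact x y \<and> \<not> horizontal x y \<and> p \<bullet> (y - x) \<le> 0 \<and> 0 \<le> q \<bullet> (y - x)}"

lemma contact_is_edge:
  assumes "contact x y"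
  shows "(x, y) \<in> horizontal_edges \<union> vertical_edges \<or> (y, x) \<in> horizontal_edges \<union> vertical_edges"
proof -
  have swap: "p \<bullet> (x - y) = - (p \<bullet> (y - x))" "q \<bullet> (x - y) = - (q \<bullet> (y - x))"
    by (simp_all add: inner_diff_right)
  have "contact y x" "horizontal y x = horizontal x y"
    using assms contact_commute horizontal_commute by auto
  moreover have "0 \<le> (p \<bullet> (y - x)) * (q \<bullet> (y - x))" if "horizontal x y"
    using that by (auto simp: horizontal_def)
  moreover have "(p \<bullet> (y - x)) * (q \<bullet> (y - x)) \<le> 0" if "\<not> horizontal x y"
    using that by (auto simp: horizontal_def)
  ultimately show ?thesis
    using assms unfolding horizontal_edges_def vertical_edges_def swap
    by (auto simp: swap zero_le_mult_iff mult_le_0_iff)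
qed

lemma horizontal_step: "(x, y) \<in> horizontal_edges \<Longrightarrow> 0 \<le> p \<bullet> (y - x) \<and> 0 \<le> q \<bullet> (y - x)"
  and vertical_step: "(x, y) \<in> vertical_edges \<Longrightarrow> 0 \<le> (- p) \<bullet> (y - x) \<and> 0 \<le> q \<bullet> (y - x)"
  by (auto simp: horizontal_edges_def vertical_edges_def)

lemma vertical_converse_step: "(x, y) \<in> vertical_edges\<inverse> \<Longrightarrow> 0 \<le> p \<bullet> (y - x) \<and> 0 \<le> (- q) \<bullet> (y - x)"
  by (auto simp: vertical_edges_def inner_diff_right)

lemma horizontal_paths: "single_valued horizontal_edges" "single_valued (horizontal_edges\<inverse>)" "acyclic horizontal_edges"
proof -
  have swap: "p \<bullet> (x - y) = - (p \<bullet> (y - x))" "q \<bullet> (x - y) = - (q \<bullet> (y - x))" for x y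
    by (simp_all add: inner_diff_right)
  show "single_valued horizontal_edges"
    using one_contact_per_quadrant[of _ _ _ 1 1] by (auto intro!: single_valuedI simp: horizontal_edges_def)
  show "single_valued (horizontal_edges\<inverse>)"
  proof (rule single_valuedI, rule ccontr)
    fix x y z assume "(x, y) \<in> horizontal_edges\<inverse>" "(x, z) \<in> horizontal_edges\<inverse>" "y \<noteq> z"
    then show False
      using one_contact_per_quadrant[of x y z "-1" "-1"] contact_commute[of x] horizontal_commute[of x]
        swap[of x y] swap[of x z] by (auto simp: horizontal_edges_def)
  qed
  show "acyclic horizontal_edges"
    unfolding acyclic_def
  proof (intro allI notI)
    fix x assume "(x, x) \<in> horizontal_edges\<^sup>+"
    then obtain y where y: "(x, y) \<in> horizontal_edges" "0 \<le> p \<bullet> (x - y)" "0 \<le> q \<bullet> (x - y)"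
      using trancl_first_step[of x x horizontal_edges p q] horizontal_step by blast
    then have "p \<bullet> y = p \<bullet> x" "q \<bullet> y = q \<bullet> x" using horizontal_step[OF y(1)] by (auto simp: inner_diff_right)
    then have "y = x" by (rule eqI_coordinates)
    then show False using y(1) by (simp add: horizontal_edges_def contact_def)
  qed
qed

lemma vertical_paths: "single_valued vertical_edges" "single_valued (vertical_edges\<inverse>)" "acyclic vertical_edges"
proof -
  have swap: "p \<bullet> (x - y) = - (p \<bullet> (y - x))" "q \<bullet> (x - y) = - (q \<bullet> (y - x))" for x y
    by (simp_all add: inner_diff_right)
  show "single_valued vertical_edges"
    using one_contact_per_quadrant[of _ _ _ "-1" 1] by (auto intro!: single_valuedI simp: vertical_edges_def)
  show "single_valued (vertical_edges\<inverse>)"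
  proof (rule single_valuedI, rule ccontr)
    fix x y z assume "(x, y) \<in> vertical_edges\<inverse>" "(x, z) \<in> vertical_edges\<inverse>" "y \<noteq> z"
    then show False
      using one_contact_per_quadrant[of x y z "1" "-1"] contact_commute[of x] horizontal_commute[of x]
        swap[of x y] swap[of x z] by (auto simp: vertical_edges_def)
  qed
  show "acyclic vertical_edges"
    unfolding acyclic_def
  proof (intro allI notI)
    fix x assume "(x, x) \<in> vertical_edges\<^sup>+"
    then obtain y where y: "(x, y) \<in> vertical_edges" "0 \<le> (- p) \<bullet> (x - y)" "0 \<le> q \<bullet> (x - y)"
      using trancl_first_step[of x x vertical_edges "- p" q] vertical_step by blast
    then have "p \<bullet> y = p \<bullet> x" "q \<bullet> y = q \<bullet> x" using vertical_step[OF y(1)] by (auto simp: inner_diff_right)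
    then have "y = x" by (rule eqI_coordinates)
    then show False using y(1) by (simp add: vertical_edges_def contact_def)
  qed
qed

text \<open>The difference of two vertices on a horizontal path lies in the closed first or third quadrant, on a
  vertical path in the closed second or fourth one. For both to hold it must be on an axis, and then so is
  every step between the vertices. There is only one contact at a vertex in a given axis direction, and
  it has one colour.\<close>

lemma paths_meet_once: "horizontal_edges\<^sup>+ \<inter> vertical_edges\<^sup>+ = {}" "horizontal_edges\<^sup>+ \<inter> (vertical_edges\<^sup>+)\<inverse> = {}"
proof -
  have False if xz: "(x, z) \<in> horizontal_edges\<^sup>+" "(x, z) \<in> vertical_edges\<^sup>+" for x z
  proof -
    obtain y where y: "(x, y) \<in> horizontal_edges" "0 \<le> p \<bullet> (z - y)" "0 \<le> q \<bullet> (z - y)"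
      using trancl_first_step[OF xz(1), of p q] horizontal_step by blast
    obtain y' where y': "(x, y') \<in> vertical_edges" "0 \<le> (- p) \<bullet> (z - y')" "0 \<le> q \<bullet> (z - y')"
      using trancl_first_step[OF xz(2), of "- p" q] vertical_step by blast
    have "p \<bullet> (y - x) = 0" "p \<bullet> (y' - x) = 0"
      using horizontal_step[OF y(1)] vertical_step[OF y'(1)] y y' by (auto simp: inner_diff_right)
    then have "y = y'" using contact_along_f[of x y] contact_along_f[of x y'] y(1) y'(1)
      by (auto simp: horizontal_edges_def vertical_edges_def)
    then show False using y(1) y'(1) by (auto simp: horizontal_edges_def vertical_edges_def)
  qed
  then show "horizontal_edges\<^sup>+ \<inter> vertical_edges\<^sup>+ = {}" by auto
  have False if xz: "(x, z) \<in> horizontal_edges\<^sup>+" "(x, z) \<in> (vertical_edges\<inverse>)\<^sup>+" for x z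
  proof -
    obtain y where y: "(x, y) \<in> horizontal_edges" "0 \<le> p \<bullet> (z - y)" "0 \<le> q \<bullet> (z - y)"
      using trancl_first_step[OF xz(1), of p q] horizontal_step by blast
    obtain y' where y': "(x, y') \<in> vertical_edges\<inverse>" "0 \<le> p \<bullet> (z - y')" "0 \<le> (- q) \<bullet> (z - y')"
      using trancl_first_step[OF xz(2), of p "- q"] vertical_converse_step by blast
    have "q \<bullet> (y - x) = 0" "q \<bullet> (y' - x) = 0" "0 \<le> p \<bullet> (y' - x)"
      using horizontal_step[OF y(1)] vertical_converse_step[OF y'(1)] y y' by (auto simp: inner_diff_right)
    then have "y = y'"
      using contact_along_e[of x y] contact_along_e[of x y'] y(1) y'(1) contact_commute[of x]
      by (auto simp: horizontal_edges_def vertical_edges_def)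
    then show False using y(1) y'(1) horizontal_commute[of x] by (auto simp: horizontal_edges_def vertical_edges_def)
  qed
  then show "horizontal_edges\<^sup>+ \<inter> (vertical_edges\<^sup>+)\<inverse> = {}" by (auto simp: trancl_converse)
qed

lemma contact_edges_bound:
  assumes "finite X"
  shows "finite (horizontal_edges \<union> vertical_edges)" "real (card (horizontal_edges \<union> vertical_edges)) \<le> 2 * real (card X) - 2 * sqrt (real (card X))"
proof -
  have sub: "horizontal_edges \<subseteq> X \<times> X" "vertical_edges \<subseteq> X \<times> X" by (auto simp: horizontal_edges_def vertical_edges_def contact_def)
  then show "finite (horizontal_edges \<union> vertical_edges)" using assms by (meson Un_least finite_SigmaI finite_subset)
  have "real (card (horizontal_edges \<union> vertical_edges)) \<le> real (card horizontal_edges + card vertical_edges)" using card_Un_le of_nat_mono by blast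
  also have "\<dots> \<le> 2 * real (card X) - 2 * sqrt (real (card X))"
    by (rule two_path_families_bound[OF assms sub(1) horizontal_paths sub(2) vertical_paths paths_meet_once])
  finally show "real (card (horizontal_edges \<union> vertical_edges)) \<le> 2 * real (card X) - 2 * sqrt (real (card X))" .
qed

end

section \<open>Totally separable packings\<close>

context symmetric_body
begin

text \<open>The midpoint of the two centres would be a common interior point.\<close>

lemma half_diff_not_interior:
  assumes "interior ((\<lambda>k. x + k) ` K) \<inter> interior ((\<lambda>k. y + k) ` K) = {}"
  shows "(1/2) *\<^sub>R (y - x) \<notin> interior K"
proof
  assume u: "(1/2) *\<^sub>R (y - x) \<in> interior K"
  have "midpoint x y = x + (1/2) *\<^sub>R (y - x)" "midpoint x y = y + - ((1/2) *\<^sub>R (y - x))"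
    by (simp_all add: midpoint_def algebra_simps vec_eq_iff)
  then have "midpoint x y \<in> (\<lambda>k. x + k) ` interior K \<inter> (\<lambda>k. y + k) ` interior K"
    using u interior_uminus by (metis IntI image_eqI)
  then show False using assms unfolding interior_translation by blast
qed

lemma touching_iff:
  assumes "x \<noteq> y" "(\<lambda>k. x + k) ` K \<noteq> (\<lambda>k. y + k) ` K"
    and "interior ((\<lambda>k. x + k) ` K) \<inter> interior ((\<lambda>k. y + k) ` K) = {}"
  shows "touching ((\<lambda>k. x + k) ` K) ((\<lambda>k. y + k) ` K) \<longleftrightarrow> (1/2) *\<^sub>R (y - x) \<in> K"
proof
  assume "touching ((\<lambda>k. x + k) ` K) ((\<lambda>k. y + k) ` K)"
  then obtain k k' where k: "k \<in> K" "k' \<in> K" "x + k = y + k'"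
    by (auto simp: touching_def frontier_translation frontier_iff)
  have "(1/2) *\<^sub>R k + (1/2) *\<^sub>R (- k') \<in> K" using k by (intro convexD convex_K) auto
  also have "(1/2) *\<^sub>R k + (1/2) *\<^sub>R (- k') = (1/2) *\<^sub>R (y - x)"
    using k(3) by (simp add: algebra_simps flip: scaleR_diff_right scaleR_add_right)
  finally show "(1/2) *\<^sub>R (y - x) \<in> K" .
next
  assume u: "(1/2) *\<^sub>R (y - x) \<in> K"
  then have fr: "(1/2) *\<^sub>R (y - x) \<in> frontier K" "- ((1/2) *\<^sub>R (y - x)) \<in> frontier K"
    using half_diff_not_interior[OF assms(3)] by (simp_all only: frontier_iff uminus_in interior_uminus simp_thms)
  have "midpoint x y = x + (1/2) *\<^sub>R (y - x)" "midpoint x y = y + - ((1/2) *\<^sub>R (y - x))"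
    by (simp_all add: midpoint_def algebra_simps vec_eq_iff)
  then have "midpoint x y \<in> (\<lambda>k. x + k) ` frontier K \<inter> (\<lambda>k. y + k) ` frontier K"
    using fr by (metis IntI image_eqI)
  then show "touching ((\<lambda>k. x + k) ` K) ((\<lambda>k. y + k) ` K)"
    using assms(2) by (auto simp: touching_def frontier_translation)
qed

text \<open>Both translates contain the midpoint of their centres, so the line passes through it. If the line
  were too close to the centre \<open>z\<close>, it would contain a proper multiple of the contact direction of \<open>x\<close>
  and \<open>y\<close>, attached to \<open>z\<close>, which is an interior point of \<open>z + K\<close>.\<close>

lemma separating_line_normal:
  assumes line: "separating_line a b ((\<lambda>k. x + k) ` K) ((\<lambda>k. y + k) ` K)"
    and avoids: "\<And>z. z \<in> X \<Longrightarrow> {v. a \<bullet> v = b} \<inter> interior ((\<lambda>k. z + k) ` K) = {}"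
    and u: "(1/2) *\<^sub>R (y - x) \<in> K"
  shows "separating_normal X x y a"
proof -
  have le: "a \<bullet> x + a \<bullet> k \<le> b" "b \<le> a \<bullet> y + a \<bullet> k" if "k \<in> K" for k
    using line that by (auto simp: separating_line_def inner_add_right)
  have "- ((1/2) *\<^sub>R (y - x)) \<in> K" using u by (simp only: uminus_in)
  then have "b \<le> a \<bullet> y - a \<bullet> ((1/2) *\<^sub>R (y - x))"
    using le(2) by (metis add_uminus_conv_diff inner_minus_right)
  moreover have "a \<bullet> ((1/2) *\<^sub>R (y - x)) = (a \<bullet> y - a \<bullet> x) / 2"
    by (simp add: inner_diff_right)
  ultimately have b: "2 * b = a \<bullet> x + a \<bullet> y" using le(1)[OF u] by argo
  have "a \<noteq> 0" using line by (simp add: separating_line_def)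
  have bound: "2 * (a \<bullet> k) \<le> a \<bullet> (y - x)" if "k \<in> K" for k
    using le(1)[OF that] b by (simp add: inner_diff_right)
  then have sup: "supports a ((1/2) *\<^sub>R (y - x))"
    using u \<open>a \<noteq> 0\<close> by (auto simp: supports_def) (metis mult.commute)
  define h where "h = a \<bullet> ((1/2) *\<^sub>R (y - x))"
  have h: "0 < h" "a \<bullet> (y - x) = 2 * h" using supports_pos[OF sup] by (simp_all add: h_def)
  have "\<bar>a \<bullet> (y - x)\<bar> \<le> \<bar>a \<bullet> (z - x) + a \<bullet> (z - y)\<bar>" if "z \<in> X" for z
  proof (rule ccontr)
    assume "\<not> \<bar>a \<bullet> (y - x)\<bar> \<le> \<bar>a \<bullet> (z - x) + a \<bullet> (z - y)\<bar>"
    then have "\<bar>b - a \<bullet> z\<bar> < h" using h b by (simp add: inner_diff_right)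
    define s where "s = (b - a \<bullet> z) / h"
    have "\<bar>s\<bar> < 1" using h \<open>\<bar>b - a \<bullet> z\<bar> < h\<close> by (simp add: s_def abs_divide)
    then have "z + s *\<^sub>R ((1/2) *\<^sub>R (y - x)) \<in> interior ((\<lambda>k. z + k) ` K)"
      unfolding interior_translation by (intro imageI shrink_interior u)
    moreover have "a \<bullet> (z + s *\<^sub>R ((1/2) *\<^sub>R (y - x))) = a \<bullet> z + s * h"
      by (simp only: inner_add_right inner_scaleR_right h_def)
    then have "a \<bullet> (z + s *\<^sub>R ((1/2) *\<^sub>R (y - x))) = b"
      using h by (simp add: s_def)
    ultimately show False using avoids[OF that] by blast
  qed
  then show ?thesis
    using \<open>a \<noteq> 0\<close> bound h by (simp add: separating_normal_def)
qed

lemma contact_number_bound: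
  assumes packing: "translative_packing K P" and separable: "totally_separable P"
    and hexagon: "\<not> quasi_hexagon K"
  shows "real (contact_number P) \<le> 2 * real (card P) - 2 * sqrt (real (card P))"
proof -
  define T where "T = (\<lambda>x :: plane. (\<lambda>k. x + k) ` K)"
  have "\<forall>A\<in>P. \<exists>x. A = T x" using packing by (simp add: translative_packing_def T_def)
  then obtain c where c: "\<And>A. A \<in> P \<Longrightarrow> A = T (c A)" by metis
  define X where "X = c ` P"
  have TX: "T x \<in> P" if "x \<in> X" for x using that c unfolding X_def by (metis imageE)
  have cT: "c (T x) = x" if "x \<in> X" for x
    using that c unfolding X_def by (metis imageE)
  have "inj_on c P" using c by (metis inj_onI)
  then have card: "card X = card P" by (simp add: X_def card_image)
  have "finite X" using packing by (simp add: X_def translative_packing_def)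
  have Tneq: "T x \<noteq> T y" if "x \<in> X" "y \<in> X" "x \<noteq> y" for x y
    using cT that by metis
  have disjoint: "interior (T x) \<inter> interior (T y) = {}" if "x \<in> X" "y \<in> X" "x \<noteq> y" for x y
    using packing Tneq[OF that] TX that by (auto simp: translative_packing_def pairwise_def)
  obtain e f p q where frame: "conjugate_frame K e f p q" "conjugate_frame.short_faces K p q"
    using short_faces_frame_exists by blast
  have ex_normal: "\<exists>a. separating_normal X x y a"
    if xy: "x \<in> X" "y \<in> X" "x \<noteq> y" "(1/2) *\<^sub>R (y - x) \<in> K" for x y
  proof -
    have "touching (T x) (T y)"
      using touching_iff[of x y] Tneq disjoint that by (simp add: T_def)
    then obtain a b where "separating_line a b (T x) (T y)" "\<forall>C\<in>P. {v. a \<bullet> v = b} \<inter> interior C = {}"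
      using separable TX[OF xy(1)] TX[OF xy(2)] unfolding totally_separable_def by blast
    then have "separating_normal X x y a"
      using TX that(4) by (intro separating_line_normal[of a b]) (auto simp: T_def)
    then show ?thesis by blast
  qed
  \<comment> \<open>The condition on a normal is symmetric in the two centres, hence so is this choice.\<close>
  define N where "N = (\<lambda>x y. SOME a. separating_normal X x y a)"
  interpret conjugate_frame K e f p q by (rule frame(1))
  interpret separated_packing K e f p q X N
  proof unfold_locales
    show "short_faces" by (rule frame(2))
    show "(1/2) *\<^sub>R (y - x) \<notin> interior K" if "x \<in> X" "y \<in> X" "x \<noteq> y" for x y
      using disjoint[OF that] half_diff_not_interior by (simp add: T_def)
    show "separating_normal X x y (N x y)"
      if "x \<in> X" "y \<in> X" "x \<noteq> y" "(1/2) *\<^sub>R (y - x) \<in> K" for x y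
      unfolding N_def by (rule someI_ex[OF ex_normal[OF that]])
    show "N x y = N y x" for x y by (simp add: N_def separating_normal_commute[of X x y])
  qed (rule hexagon)
  have "{{A, B} | A B. A \<in> P \<and> B \<in> P \<and> touching A B} \<subseteq> (\<lambda>(x, y). {T x, T y}) ` (horizontal_edges \<union> vertical_edges)"
  proof clarify
    fix A B assume AB: "A \<in> P" "B \<in> P" "touching A B"
    then have X: "c A \<in> X" "c B \<in> X" and T: "T (c A) = A" "T (c B) = B"
      using c by (auto simp: X_def)
    have "A \<noteq> B" using AB(3) by (simp add: touching_def)
    then have ne: "c A \<noteq> c B" using T by metis
    have "touching (T (c A)) (T (c B))" using AB(3) T by simp
    then have "(1/2) *\<^sub>R (c B - c A) \<in> K"
      using touching_iff[OF ne Tneq[OF X ne, unfolded T_def] disjoint[OF X ne, unfolded T_def]]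
      by (simp add: T_def)
    then have "contact (c A) (c B)" using X ne by (simp add: contact_def)
    then have "(c A, c B) \<in> horizontal_edges \<union> vertical_edges \<or> (c B, c A) \<in> horizontal_edges \<union> vertical_edges" by (rule contact_is_edge)
    then show "{A, B} \<in> (\<lambda>(x, y). {T x, T y}) ` (horizontal_edges \<union> vertical_edges)"
    proof
      assume "(c A, c B) \<in> horizontal_edges \<union> vertical_edges"
      then show ?thesis by (rule rev_image_eqI) (simp add: T)
    next
      assume "(c B, c A) \<in> horizontal_edges \<union> vertical_edges"
      then show ?thesis by (rule rev_image_eqI) (simp add: T insert_commute)
    qed
  qed
  then have "contact_number P \<le> card (horizontal_edges \<union> vertical_edges)"
    unfolding contact_number_def
    using contact_edges_bound(1)[OF \<open>finite X\<close>] by (rule surj_card_le[rotated])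
  then have "real (contact_number P) \<le> real (card (horizontal_edges \<union> vertical_edges))" by simp
  also have "\<dots> \<le> 2 * real (card P) - 2 * sqrt (real (card P))"
    using contact_edges_bound(2)[OF \<open>finite X\<close>] by (simp only: card)
  finally show ?thesis .
qed

text \<open>Translates spread out along a line never touch, so packings of every size exist.\<close>

lemma totally_separable_packing_exists:
  "\<exists>P. translative_packing K P \<and> totally_separable P \<and> card P = n"
proof -
  obtain M where M: "0 < M" "\<And>k. k \<in> K \<Longrightarrow> norm k \<le> M"
    using compact_imp_bounded[OF compact_K] bounded_pos by metis
  define x :: "nat \<Rightarrow> plane" where "x = (\<lambda>i. (3 * M * real i) *\<^sub>R axis 1 1)"
  define T where "T = (\<lambda>i. (\<lambda>k. x i + k) ` K)"
  have far: "3 * M \<le> norm (x i - x j)" if "i \<noteq> j" for i j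
  proof -
    have "x i - x j = (3 * M * (real i - real j)) *\<^sub>R axis 1 1"
      by (simp add: x_def algebra_simps)
    then have "norm (x i - x j) = 3 * M * \<bar>real i - real j\<bar>"
      using M(1) by (simp add: abs_mult norm_eq_sqrt_inner[of "axis 1 1"] inner_axis_axis)
    moreover have "1 \<le> \<bar>real i - real j\<bar>" using that by linarith
    ultimately show ?thesis using M(1) by simp
  qed
  have disj: "T i \<inter> T j = {}" if "i \<noteq> j" for i j
  proof (rule ccontr)
    assume "T i \<inter> T j \<noteq> {}"
    then obtain k k' where k: "k \<in> K" "k' \<in> K" "x i + k = x j + k'" by (auto simp: T_def)
    then have "x i - x j = k' - k" by (simp add: algebra_simps)
    then have "norm (x i - x j) \<le> M + M"
      using M(2)[OF k(1)] M(2)[OF k(2)] norm_triangle_ineq4[of k' k] by simp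
    then show False using far[OF that] M(1) by simp
  qed
  have closed: "closed (T i)" for i using closed_K by (simp add: T_def closed_translation)
  have ne: "T i \<noteq> {}" for i using zero_in by (auto simp: T_def)
  have inj: "inj T" using disj ne by (metis inf.idem injI)
  have no_touch: "\<not> touching (T i) (T j)" for i j
  proof (cases "i = j")
    case False
    have "frontier (T i) \<inter> frontier (T j) \<subseteq> T i \<inter> T j"
      using frontier_subset_closed[OF closed] by blast
    then show ?thesis using disj[OF False] by (auto simp: touching_def)
  qed (simp add: touching_def)
  have "translative_packing K (T ` {..<n})"
    unfolding translative_packing_def
  proof (intro conjI)
    show "\<forall>A\<in>T ` {..<n}. \<exists>x. A = (\<lambda>y. x + y) ` K" unfolding T_def by blast
    have "interior (T i) \<inter> interior (T j) = {}" if "T i \<noteq> T j" for i j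
      using disj[of i j] that interior_subset[of "T i"] interior_subset[of "T j"] by blast
    then show "pairwise (\<lambda>A B. interior A \<inter> interior B = {}) (T ` {..<n})"
      unfolding pairwise_def by blast
  qed simp
  moreover have "totally_separable (T ` {..<n})" using no_touch by (auto simp: totally_separable_def)
  moreover have "card (T ` {..<n}) = n" using inj by (simp add: card_image inj_on_subset)
  ultimately show ?thesis by blast
qed

end

theorem theorem5:
  fixes K :: "(real ^ 2) set" and n :: nat
  assumes "convex_body K" and "o_symmetric K" and "\<not> quasi_hexagon K" and "n \<ge> 1"
  shows "int (c_sep K n) \<le> \<lfloor>2 * real n - 2 * sqrt (real n)\<rfloor>"
proof -
  interpret symmetric_body K using assms by unfold_locales
  define C where "C = {contact_number P | P. translative_packing K P \<and> totally_separable P \<and> card P = n}"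
  have bound: "real m \<le> 2 * real n - 2 * sqrt (real n)" if "m \<in> C" for m
    using that contact_number_bound assms(3) unfolding C_def by blast
  have "C \<subseteq> {..2 * n}"
  proof
    fix m assume "m \<in> C"
    then have "real m \<le> 2 * real n" using bound[of m] real_sqrt_ge_zero[of "real n"] by linarith
    then show "m \<in> {..2 * n}" by simp
  qed
  then have "finite C" by (rule finite_subset) simp
  moreover have "C \<noteq> {}" using totally_separable_packing_exists unfolding C_def by blast
  ultimately have "c_sep K n \<in> C" unfolding c_sep_def C_def[symmetric] by (rule Max_in)
  then show ?thesis using bound by (simp add: le_floor_iff)
qed

end
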